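(* Let $(b_n)_{n\in\mathbb{N}}\subseteq\mathbb{C}$ and $(c_n)_{n\in\mathbb{N}}\subseteq\mathbb{N}$ be sequences such that $b_n/n\to\beta$ and $c_n/n\to\gamma$ as $n\to\infty$, where $\beta\in\mathbb{C}$ and $\gamma>0$ are constants. (a) (Positive case) If $b_n\in\mathbb{R}\setminus[-n,0]$ for every $n\in\mathbb{N}$ and $\beta\in\mathbb{R}\setminus[-1,0]$, then $[\![L_n^*(\cdot;b_n,c_n)]\!]_n$ converges weakly to some probability measure $\nu_{\beta,\gamma}$ on $[0,\infty)$. (b) (Unitary case) If $\operatorname{Re}b_n=-n/2$ for every $n\in\mathbb{N}$ (and hence $\operatorname{Re}\beta=-1/2$), then $[\![L_n^*(\cdot;b_n,c_n)]\!]_n$ converges weakly to some probability measure $\nu_{\beta,\gamma}$ on the unit circle. (c) In both cases, the $S$-transform of $\nu_{\beta,\gamma}$ is given by $$S(y)=\exp\left(\frac{\gamma}{\beta+1+y}\right).$$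
   Context: $\mathbb{N}=\{1,2,\dots\}$, $\mathbb{N}_0=\{0,1,\dots\}$. For $c\in\mathbb{N}_0$, $b\in\mathbb{C}$, $n\in\mathbb{N}_0$ the multiplicative Laguerre polynomials are $$L_n^*(x;b,c):=(x\partial_x+b)^c(x-1)^n=\sum_{j=0}^n(-1)^{n-j}\binom nj(j+b)^cx^j.$$ For a polynomial $P\in\mathbb{C}[x]$ of degree $n\in\mathbb{N}$, $[\![P]\!]_n:=\frac1n\sum_{z\in\mathbb{C}:P(z)=0}\delta_z$ (zeros counted with multiplicity). For a compactly supported probability measure $\mu$ on $\mathbb{C}$ (here on $[0,\infty)$ or the unit circle) with moments $m_k=\int x^k\mu(dx)$, $m_1\ne0$, put $\psi_\mu(t)=\sum_{k\ge1}m_kt^k$; the $S$-transform of $\mu$ is the analytic function near $0$ defined by $S_\mu(\psi_\mu(t))=\frac{1+\psi_\mu(t)}{\psi_\mu(t)}\,t$. *)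

theory Defs
  imports "HOL-Probability.Probability" "HOL-Computational_Algebra.Polynomial"
begin

definition euler_op :: "complex \<Rightarrow> complex poly \<Rightarrow> complex poly" where
  "euler_op b P = [:0, 1:] * pderiv P + smult b P"

definition mult_laguerre :: "nat \<Rightarrow> complex \<Rightarrow> nat \<Rightarrow> complex poly" where
  "mult_laguerre n b c = (euler_op b ^^ c) ([:-1, 1:] ^ n)"

lemma coeff_euler_op: "coeff (euler_op b P) j = (of_nat j + b) * coeff P j"
  by (cases j) (auto simp: euler_op_def coeff_pderiv algebra_simps)

lemma mult_laguerre_altdef:
  "mult_laguerre n b c =
     (\<Sum>j\<le>n. monom ((-1) ^ (n - j) * of_nat (n choose j) * (of_nat j + b) ^ c) j)"
proof (rule poly_eqI)
  fix k
  have lin: "coeff ([:-1, 1:] ^ n :: complex poly) k =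
      (if k \<le> n then (-1) ^ (n - k) * of_nat (n choose k) else 0)"
  proof -
    have "[:-1, 1:] ^ n = (monom 1 1 + [:-1:] :: complex poly) ^ n"
      by (simp add: monom_altdef)
    also have "\<dots> = (\<Sum>j\<le>n. monom ((-1) ^ (n - j) * of_nat (n choose j)) j)"
      by (simp add: binomial_ring monom_power poly_const_pow of_nat_poly smult_monom
          mult.commute)
    finally show ?thesis
      by (simp add: coeff_sum)
  qed
  have "coeff (mult_laguerre n b c) k = (of_nat k + b) ^ c * coeff ([:-1, 1:] ^ n) k"
    unfolding mult_laguerre_def by (induction c) (auto simp: coeff_euler_op)
  then show "coeff (mult_laguerre n b c) k =
      coeff (\<Sum>j\<le>n. monom ((-1) ^ (n - j) * of_nat (n choose j) * (of_nat j + b) ^ c) j) k"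
    by (simp add: lin coeff_sum mult_ac)
qed

text \<open>The measure \<open>1/n \<Sum> \<delta>\<^sub>z\<close> over the zeros of a polynomial of degree \<open>n \<ge> 1\<close>;
  here \<open>return borel z\<close> is the Dirac measure at \<open>z\<close>, and the multiplicity of a zero appears
  as the weight \<open>order z P\<close>.\<close>

definition zero_dist :: "nat \<Rightarrow> complex poly \<Rightarrow> complex measure" where
  "zero_dist n P = measure_of UNIV (sets borel)
     (\<lambda>A. \<Sum>z | poly P z = 0. ennreal (real (order z P) / real n) * emeasure (return borel z) A)"

lemma sets_zero_dist [simp]: "sets (zero_dist n P) = sets borel"
  using sets.sigma_sets_eq[of "borel :: complex measure"] by (simp add: zero_dist_def)

lemma emeasure_zero_dist:
  assumes "A \<in> sets borel"
  shows "emeasure (zero_dist n P) A =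
    (\<Sum>z | poly P z = 0. ennreal (real (order z P) / real n) * emeasure (return borel z) A)"
proof (rule emeasure_measure_of[OF zero_dist_def])
  show "countably_additive (sets (zero_dist n P)) (\<lambda>A. \<Sum>z | poly P z = 0.
      ennreal (real (order z P) / real n) * emeasure (return borel z) A)"
  proof (rule countably_additiveI)
    fix F :: "nat \<Rightarrow> complex set"
    assume F: "range F \<subseteq> sets (zero_dist n P)" "disjoint_family F"
    have "(\<Sum>i. \<Sum>z | poly P z = 0. ennreal (real (order z P) / real n)
        * emeasure (return borel z) (F i)) =
      (\<Sum>z | poly P z = 0. \<Sum>i. ennreal (real (order z P) / real n)
        * emeasure (return borel z) (F i))"
      by (intro suminf_sum) auto
    also have "\<dots> = (\<Sum>z | poly P z = 0. ennreal (real (order z P) / real n)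
        * emeasure (return borel z) (\<Union>i. F i))"
      using F by (simp add: suminf_indicator image_subset_iff sets.countable_UN)
    finally show "(\<Sum>i. \<Sum>z | poly P z = 0. ennreal (real (order z P) / real n)
        * emeasure (return borel z) (F i)) = (\<Sum>z | poly P z = 0.
        ennreal (real (order z P) / real n) * emeasure (return borel z) (\<Union>i. F i))" .
  qed
qed (use assms in \<open>auto simp: positive_def\<close>)

text \<open>\<open>weak_conv_m\<close> of the library concerns distribution functions on the real line only.\<close>

definition weakly_converges ::
    "(nat \<Rightarrow> 'a::topological_space measure) \<Rightarrow> 'a measure \<Rightarrow> bool" where
  "weakly_converges M N \<longleftrightarrow>
     (\<forall>f :: 'a \<Rightarrow> real. continuous_on UNIV f \<and> bounded (range f) \<longrightarrow>
        (\<lambda>n. \<integral>x. f x \<partial>M n) \<longlonglongrightarrow> (\<integral>x. f x \<partial>N))"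

definition prob_measure_on :: "complex set \<Rightarrow> complex measure \<Rightarrow> bool" where
  "prob_measure_on S N \<longleftrightarrow> prob_space N \<and> sets N = sets borel \<and> (AE x in N. x \<in> S)"

definition moment :: "complex measure \<Rightarrow> nat \<Rightarrow> complex" where
  "moment N k = (\<integral>x. x ^ k \<partial>N)"

definition psi :: "complex measure \<Rightarrow> complex \<Rightarrow> complex" where
  "psi N t = (\<Sum>k. moment N (Suc k) * t ^ Suc k)"

text \<open>An $S$-transform is a germ at 0: the predicate says that \<open>N\<close> has an $S$-transform
  (compact support, nonzero mean) and that it agrees with \<open>S\<close> near 0. The functional equation
  is required in a punctured neighbourhood of 0, where \<open>psi N t\<close> does not vanish.\<close>

definition has_S_transform :: "complex measure \<Rightarrow> (complex \<Rightarrow> complex) \<Rightarrow> bool" where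
  "has_S_transform N S \<longleftrightarrow>
     (\<exists>K. compact K \<and> prob_measure_on K N) \<and> moment N 1 \<noteq> 0 \<and>
     S analytic_on {0} \<and>
     (\<forall>\<^sub>F t in at 0. S (psi N t) = (1 + psi N t) / psi N t * t)"

definition positive_case :: "(nat \<Rightarrow> complex) \<Rightarrow> complex \<Rightarrow> bool" where
  "positive_case b \<beta> \<longleftrightarrow>
     (\<forall>n\<ge>1. b n \<in> \<real> - complex_of_real ` {- real n..0}) \<and>
     \<beta> \<in> \<real> - complex_of_real ` {-1..0}"

definition unitary_case :: "(nat \<Rightarrow> complex) \<Rightarrow> bool" where
  "unitary_case b \<longleftrightarrow> (\<forall>n\<ge>1. Re (b n) = - real n / 2)"

end

theory Submission
  imports Defs "HOL-Complex_Analysis.Complex_Analysis"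
    "HOL-Computational_Algebra.Fundamental_Theorem_Algebra"
begin

text \<open>Write \<open>P\<^sub>c\<close> for the \<open>c\<close>-fold image of \<open>(x - 1) ^ n\<close> under the Euler operator \<open>x d/dx + b\<close>, and
  \<open>\<psi>\<^sub>c t\<close> for the average of \<open>z t / (1 - z t)\<close> over the zeros \<open>z\<close> of \<open>P\<^sub>c\<close>, which is the function \<open>\<psi>\<close>
  of the zero distribution. Since \<open>x P' / P = n (1 + \<psi> (1 / x))\<close>, one application of the operator
  multiplies \<open>P\<^sub>c\<close> by \<open>n (q + \<psi>\<^sub>c (1 / x))\<close> with \<open>q = 1 + b / n\<close>, and logarithmic differentiation gives
  \<open>\<psi>\<^bsub>c+1\<^esub> = \<psi>\<^sub>c - (1 / n) t \<psi>\<^sub>c' / (q + \<psi>\<^sub>c)\<close>. This is an Euler scheme with step \<open>1 / n\<close> for the transport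
  equation \<open>\<partial>\<psi> / \<partial>s = - t (\<partial>\<psi> / \<partial>t) / (\<beta> + 1 + \<psi>)\<close>, started from \<open>\<psi> = t / (1 - t)\<close>.
  Along its characteristics \<open>\<psi>\<close> keeps a constant value \<open>y\<close>, while \<open>t\<close> moves from \<open>y / (1 + y)\<close> to
  \<open>y / (1 + y) * exp (s / (\<beta> + 1 + y))\<close>; at time \<open>s = \<gamma>\<close> this is the inverse function of \<open>\<psi>\<close>, and hence
  the claimed \<open>S\<close>-transform.

  The error along a characteristic obeys a discrete Gronwall inequality (\<open>characteristic_step_error\<close>,
  \<open>characteristic_error\<close>), provided that the zeros of all \<open>P\<^sub>c\<close> lie in a disc that is independent of \<open>n\<close>.
  In the unitary case they stay on the unit circle (\<open>euler_op_zeros_unitary\<close>); in the positive case they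
  stay on the positive half-line (\<open>euler_op_zeros_positive\<close>), below \<open>1\<close> if \<open>b > 0\<close>, and below a barrier
  that itself moves along a characteristic if \<open>b < - n\<close> (\<open>euler_op_zeros_barrier\<close>). Therefore
  \<open>\<psi>\<close> of the zero distributions converges near \<open>0\<close> (\<open>zero_psi_tendsto\<close>).

  The zeros lie on a curve parametrised by a compact interval, so Helly's theorem supplies weakly convergent
  subsequences (\<open>helly_on_curve\<close>). Each limit has the same \<open>\<psi>\<close> near \<open>0\<close>, hence the same moments.
  On the real line and on the circle, moments determine all integrals of polynomials in \<open>z\<close> and its
  conjugate, and then by Stone and Weierstrass all integrals of continuous functions
  (\<open>integral_eq_of_moments_eq\<close>). So all subsequential limits agree and the whole sequence converges.\<close>

section \<open>Averages over the zeros of a polynomial\<close>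

definition zero_mean :: "complex poly \<Rightarrow> (complex \<Rightarrow> complex) \<Rightarrow> complex" where
  "zero_mean P f = (\<Sum>z | poly P z = 0. of_nat (order z P) * f z) / of_nat (degree P)"

lemma sum_order_complex:
  fixes P :: "complex poly"
  assumes "P \<noteq> 0"
  shows "(\<Sum>z | poly P z = 0. order z P) = degree P"
proof -
  have fin: "finite {z. poly P z = 0}" using assms by (rule poly_roots_finite)
  have "degree P = degree (\<Prod>z|poly P z = 0. [:-z, 1:] ^ order z P)"
    by (subst (1) complex_poly_decompose [symmetric]) (use assms in simp)
  also have "\<dots> = (\<Sum>z | poly P z = 0. degree ([:-z, 1:] ^ order z P))"
    by (intro degree_prod_eq_sum_degree) auto
  also have "\<dots> = (\<Sum>z | poly P z = 0. order z P)"
    by (simp add: degree_linear_power)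
  finally show ?thesis by simp
qed

lemma zero_mean_const:
  assumes "degree P > 0"
  shows "zero_mean P (\<lambda>_. a) = a"
proof -
  have "P \<noteq> 0" using assms by auto
  then have "(\<Sum>z | poly P z = 0. of_nat (order z P) :: complex) = of_nat (degree P)"
    by (simp flip: sum_order_complex)
  with assms show ?thesis
    by (simp add: zero_mean_def flip: sum_distrib_right)
qed

lemma zero_mean_add: "zero_mean P (\<lambda>z. f z + g z) = zero_mean P f + zero_mean P g"
  by (simp add: zero_mean_def distrib_left sum.distrib add_divide_distrib)

lemma zero_mean_diff: "zero_mean P (\<lambda>z. f z - g z) = zero_mean P f - zero_mean P g"
  by (simp add: zero_mean_def right_diff_distrib sum_subtractf diff_divide_distrib)

lemma zero_mean_cmult: "zero_mean P (\<lambda>z. a * f z) = a * zero_mean P f"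
  by (simp add: zero_mean_def sum_distrib_left mult_ac)

lemma zero_mean_cong:
  assumes "\<And>z. poly P z = 0 \<Longrightarrow> f z = g z"
  shows "zero_mean P f = zero_mean P g"
  using assms by (simp add: zero_mean_def)

lemma zero_mean_Im: "Im (zero_mean P f) = Re (zero_mean P (\<lambda>z. of_real (Im (f z))))"
  by (simp add: zero_mean_def Im_divide_of_nat Re_divide_of_nat)

lemma zero_mean_of_real:
  assumes "\<And>z. poly P z = 0 \<Longrightarrow> f z \<in> \<real>"
  shows "of_real (Re (zero_mean P f)) = zero_mean P f"
proof -
  have "zero_mean P f \<in> \<real>" unfolding zero_mean_def
    using assms by (intro Reals_divide sum_in_Reals Reals_mult) auto
  then show ?thesis by simp
qed

lemma zero_mean_Re_mono:
  assumes "\<And>z. poly P z = 0 \<Longrightarrow> Re (f z) \<le> Re (g z)"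
  shows "Re (zero_mean P f) \<le> Re (zero_mean P g)"
  using assms unfolding zero_mean_def
  by (auto simp: Re_divide_of_nat intro!: divide_right_mono sum_mono mult_left_mono)

lemma zero_mean_Re_less:
  assumes "degree P > 0" and "\<And>z. poly P z = 0 \<Longrightarrow> Re (f z) < Re (g z)"
  shows "Re (zero_mean P f) < Re (zero_mean P g)"
proof -
  have nz: "P \<noteq> 0" using assms(1) by auto
  have "\<not> constant (poly P)" using assms(1) by (simp add: constant_degree)
  then have "{z. poly P z = 0} \<noteq> {}"
    using fundamental_theorem_of_algebra by auto
  moreover have "0 < order z P" if "poly P z = 0" for z
    using that nz by (simp add: order_root)
  ultimately show ?thesis
    using assms nz unfolding zero_mean_def
    by (auto simp: Re_divide_of_nat poly_roots_finite
        intro!: divide_strict_right_mono sum_strict_mono mult_strict_left_mono)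
qed

lemma norm_zero_mean_le:
  assumes "\<And>z. poly P z = 0 \<Longrightarrow> norm (f z) \<le> B" and "degree P > 0"
  shows "norm (zero_mean P f) \<le> B"
proof -
  have nz: "P \<noteq> 0" using assms by auto
  have "norm (zero_mean P f) \<le> (\<Sum>z | poly P z = 0. real (order z P) * B) / real (degree P)"
    using assms unfolding zero_mean_def norm_divide norm_of_nat
    by (intro divide_right_mono order.trans[OF norm_sum] sum_mono)
       (auto simp: norm_mult intro!: mult_left_mono)
  also have "\<dots> = real (degree P) * B / real (degree P)"
    using sum_order_complex[OF nz] by (simp flip: sum_distrib_right of_nat_sum)
  finally show ?thesis using assms(2) by simp
qed

section \<open>The Euler operator and the transform of the zero distribution\<close>

lemma poly_log_deriv:
  fixes P :: "complex poly"
  assumes "poly P x \<noteq> 0"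
  shows "x * poly (pderiv P) x = poly P x * (of_nat (degree P) * zero_mean P (\<lambda>z. x / (x - z)))"
proof (cases "degree P = 0")
  case True
  then show ?thesis by (auto elim!: degree_eq_zeroE)
next
  case False
  let ?Z = "{z. poly P z = 0}"
  have nz: "P \<noteq> 0" using assms by auto
  have fin: "finite ?Z" using nz by (rule poly_roots_finite)
  have dec: "poly P = (\<lambda>x. lead_coeff P * (\<Prod>z\<in>?Z. (x - z) ^ order z P))"
  proof
    fix x
    show "poly P x = lead_coeff P * (\<Prod>z\<in>?Z. (x - z) ^ order z P)"
      by (subst complex_poly_decompose [symmetric]) (simp add: poly_prod)
  qed
  have "((\<lambda>x. \<Prod>z\<in>?Z. (x - z) ^ order z P) has_field_derivative
      (\<Prod>z\<in>?Z. (x - z) ^ order z P) *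
      (\<Sum>z\<in>?Z. (of_nat (order z P) * (x - z) ^ (order z P - 1)) / (x - z) ^ order z P)) (at x)"
    using assms by (intro has_field_derivative_prod') (auto intro!: derivative_eq_intros)
  also have "(\<Sum>z\<in>?Z. (of_nat (order z P) * (x - z) ^ (order z P - 1)) / (x - z) ^ order z P) =
     (\<Sum>z\<in>?Z. of_nat (order z P) / (x - z))"
  proof (rule sum.cong)
    fix z assume z: "z \<in> ?Z"
    then have "order z P > 0" using nz by (simp add: order_root)
    then have eq: "(x - z) ^ order z P = (x - z) * (x - z) ^ (order z P - 1)"
      by (cases "order z P") auto
    have "x - z \<noteq> 0" using assms z by auto
    then show "(of_nat (order z P) * (x - z) ^ (order z P - 1)) / (x - z) ^ order z P
       = of_nat (order z P) / (x - z)" by (subst eq) simp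
  qed simp
  finally have "(poly P has_field_derivative poly P x * (\<Sum>z\<in>?Z. of_nat (order z P) / (x - z))) (at x)"
    by (subst (1) dec, subst dec) (auto intro!: derivative_eq_intros)
  then have "poly (pderiv P) x = poly P x * (\<Sum>z\<in>?Z. of_nat (order z P) / (x - z))"
    using poly_DERIV DERIV_unique by blast
  moreover have "of_nat (degree P) * zero_mean P (\<lambda>z. x / (x - z)) =
      x * (\<Sum>z\<in>?Z. of_nat (order z P) / (x - z))"
    using False by (simp add: zero_mean_def) (simp add: sum_distrib_left mult_ac)
  ultimately show ?thesis
    by (simp add: mult_ac)
qed

lemma poly_euler_op:
  assumes "poly P x \<noteq> 0"
  shows "poly (euler_op b P) x =
    poly P x * (of_nat (degree P) * zero_mean P (\<lambda>z. x / (x - z)) + b)"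
  using poly_log_deriv[OF assms] by (simp add: euler_op_def algebra_simps)

lemma degree_euler_op:
  assumes "of_nat (degree P) + b \<noteq> 0"
  shows "degree (euler_op b P) = degree P"
proof (cases "P = 0")
  case True then show ?thesis by (simp add: euler_op_def)
next
  case False
  show ?thesis
  proof (rule antisym)
    show "degree (euler_op b P) \<le> degree P"
      by (rule degree_le) (auto simp: coeff_euler_op coeff_eq_0)
    show "degree P \<le> degree (euler_op b P)"
      by (rule le_degree) (use assms False in \<open>auto simp: coeff_euler_op\<close>)
  qed
qed

text \<open>The function \<open>\<psi>\<close> of the zero distribution, and below it \<open>t\<close> times its derivative.\<close>
definition zero_psi :: "complex poly \<Rightarrow> complex \<Rightarrow> complex" where
  "zero_psi P t = zero_mean P (\<lambda>z. z * t / (1 - z * t))"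

definition zero_psi' :: "complex poly \<Rightarrow> complex \<Rightarrow> complex" where
  "zero_psi' P t = zero_mean P (\<lambda>z. z * t / (1 - z * t)^2)"

lemma zero_mean_eq_zero_psi:
  assumes "degree P > 0" "x \<noteq> 0" "poly P x \<noteq> 0"
  shows "zero_mean P (\<lambda>z. x / (x - z)) = 1 + zero_psi P (1/x)"
proof -
  have "zero_mean P (\<lambda>z. x / (x - z)) = zero_mean P (\<lambda>z. 1 + z * (1/x) / (1 - z * (1/x)))"
  proof (rule zero_mean_cong)
    fix z assume "poly P z = 0"
    then have "x \<noteq> z" using assms by auto
    then have "x - z \<noteq> 0" "1 - z * (1/x) = (x - z)/x"
      using assms by (auto simp: field_simps)
    then show "x / (x - z) = 1 + z * (1/x) / (1 - z * (1/x))"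
      using assms by (simp add: field_simps)
  qed
  also have "\<dots> = 1 + zero_psi P (1/x)"
    using zero_mean_const[OF assms(1)] by (simp add: zero_mean_add zero_psi_def)
  finally show ?thesis .
qed

lemma DERIV_zero_mean:
  assumes "degree P > 0" "poly P x \<noteq> 0"
  shows "((\<lambda>x. zero_mean P (\<lambda>z. x / (x - z))) has_field_derivative
    zero_mean P (\<lambda>z. - z / (x - z)^2)) (at x)"
proof -
  have "x \<noteq> z" if "poly P z = 0" for z using assms that by auto
  then show ?thesis using assms(1) unfolding zero_mean_def
    by (auto intro!: derivative_eq_intros sum.cong simp: divide_simps power2_eq_square)
       (auto simp: algebra_simps)
qed

text \<open>The evolution step. With \<open>x = 1 / t\<close> and \<open>u = 1 + \<psi> (1 / x)\<close>, the new polynomial is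
  \<open>P * n * (u + b / n)\<close>, so its logarithmic derivative is that of \<open>P\<close> plus the one of \<open>u + b / n\<close>.\<close>
lemma zero_psi_euler_op:
  assumes deg: "degree P > 0" and q: "q = 1 + b / of_nat (degree P)" and q0: "q \<noteq> 0" 
    and t: "t \<noteq> 0" "poly P (1/t) \<noteq> 0" and nz: "q + zero_psi P t \<noteq> 0"
  shows "zero_psi (euler_op b P) t = zero_psi P t - zero_psi' P t / (of_nat (degree P) * (q + zero_psi P t))"
proof -
  define n where "n = (of_nat (degree P) :: complex)"
  define Q where "Q = euler_op b P"
  define x where "x = 1/t"
  define u where "u P x = zero_mean P (\<lambda>z. x / (x - z))" for P x
  have n0: "n \<noteq> 0" using deg by (simp add: n_def)
  have x: "x \<noteq> 0" "t = 1/x" "poly P x \<noteq> 0" using t by (auto simp: x_def)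
  have b: "b = n * (q - 1)" using n0 q by (simp add: n_def)
  have degQ: "degree Q = degree P" unfolding Q_def
    by (rule degree_euler_op) (use n0 q0 b n_def in \<open>auto simp: algebra_simps\<close>)
  have uP: "u P x = 1 + zero_psi P t" using x deg by (simp add: u_def zero_mean_eq_zero_psi)
  have Q: "poly Q x = poly P x * (n * u P x + b)" if "poly P x \<noteq> 0" for x
    using poly_euler_op[OF that] by (simp add: Q_def n_def u_def)
  have nub: "n * u P x + b = n * (q + zero_psi P t)" by (simp add: uP b algebra_simps)
  have Qx: "poly Q x \<noteq> 0" using Q[OF x(3)] x nz n0 by (auto simp: nub)
  have uQ: "u Q x = 1 + zero_psi Q t" using x deg degQ Qx by (simp add: u_def zero_mean_eq_zero_psi)
  have ev: "eventually (\<lambda>w. poly P w \<noteq> 0) (nhds x)"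
    by (subst eventually_nhds) (intro exI[of _ "{w. poly P w \<noteq> 0}"], use x in \<open>auto intro!: open_Collect_neq continuous_intros\<close>)
  define u' where "u' = zero_mean P (\<lambda>z. - z / (x - z)^2)"
  have "((\<lambda>w. poly P w * (n * u P w + b)) has_field_derivative
      poly (pderiv P) x * (n * u P x + b) + poly P x * (n * u')) (at x)"
    using DERIV_zero_mean[OF deg x(3)] unfolding u_def[symmetric] u'_def[symmetric]
    by (auto intro!: derivative_eq_intros)
  then have "(poly Q has_field_derivative
      poly (pderiv P) x * (n * u P x + b) + poly P x * (n * u')) (at x)"
    by (subst DERIV_cong_ev[OF refl _ refl]) (use ev Q in \<open>auto elim: eventually_mono\<close>)
  then have "poly (pderiv Q) x = poly (pderiv P) x * (n * u P x + b) + poly P x * (n * u')"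
    using poly_DERIV DERIV_unique by blast
  then have "x * poly (pderiv Q) x = poly P x * (n * u P x) * (n * u P x + b) + poly P x * (n * (x * u'))"
    using poly_log_deriv[OF x(3)] by (simp add: algebra_simps u_def n_def)
  also have "x * poly (pderiv Q) x = poly P x * (n * u P x + b) * (n * u Q x)"
    using poly_log_deriv[OF Qx] Q[OF x(3)] by (simp add: u_def n_def degQ)
  finally have "(n * u P x + b) * (n * u Q x) = (n * u P x) * (n * u P x + b) + n * (x * u')"
    using x by (metis (no_types, lifting) distrib_left mult.assoc mult_left_cancel)
  then have "n * ((q + zero_psi P t) * n * (1 + zero_psi Q t)) = n * ((1 + zero_psi P t) * n * (q + zero_psi P t) + x * u')"
    unfolding nub unfolding uQ uP by (simp add: algebra_simps)
  then have main: "(q + zero_psi P t) * n * (1 + zero_psi Q t) = (1 + zero_psi P t) * n * (q + zero_psi P t) + x * u'"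
    using mult_left_cancel[OF n0] by blast
  have "x * u' = - zero_psi' P t"
  proof -
    have "x * u' = zero_mean P (\<lambda>z. x * (- z / (x - z)^2))" by (simp add: u'_def flip: zero_mean_cmult)
    also have "\<dots> = zero_mean P (\<lambda>z. -1 * (z * t / (1 - z * t)^2))"
    proof (rule zero_mean_cong)
      fix z assume "poly P z = 0"
      then have "x \<noteq> z" using x by auto
      then have "x - z \<noteq> 0" and eq: "1 - z * t = (x - z)/x"
        using x by (auto simp: field_simps)
      have "z * t / (1 - z * t)^2 = x * (z / (x - z)^2)"
        unfolding eq using x by (simp add: power_divide power2_eq_square)
      then show "x * (- z / (x - z)^2) = -1 * (z * t / (1 - z * t)^2)" by simp
    qed
    finally show ?thesis unfolding zero_mean_cmult zero_psi'_def by simp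
  qed
  with main have "n * (q + zero_psi P t) * (zero_psi P t - zero_psi Q t) = zero_psi' P t"
    by (simp add: algebra_simps)
  then have "zero_psi P t - zero_psi Q t = zero_psi' P t / (n * (q + zero_psi P t))"
    using n0 nz by (metis nonzero_mult_div_cancel_left no_zero_divisors)
  then show ?thesis by (simp add: n_def Q_def algebra_simps)
qed

section \<open>How the Euler operator moves the zeros\<close>

text \<open>A zero \<open>x\<close> of the image that is not a zero of \<open>P\<close> makes the average of \<open>x / (x - z)\<close> equal to
  \<open>- b / n\<close>, which has real part \<open>1/2\<close>. For \<open>z\<close> on the unit circle, the real part of \<open>x / (x - z)\<close> is
  greater than \<open>1/2\<close> outside the circle and less than \<open>1/2\<close> inside.\<close>
lemma euler_op_zeros_unitary:
  assumes deg: "degree P > 0" and b: "Re b = - real (degree P) / 2"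
    and zeros: "\<And>z. poly P z = 0 \<Longrightarrow> norm z = 1" and x: "poly (euler_op b P) x = 0"
  shows "norm x = 1"
proof (rule ccontr)
  assume x1: "norm x \<noteq> 1"
  then have "poly P x \<noteq> 0" using zeros by auto
  then have "of_nat (degree P) * zero_mean P (\<lambda>z. x / (x - z)) + b = 0"
    using poly_euler_op x by fastforce
  from arg_cong[OF this, of Re]
  have half: "Re (zero_mean P (\<lambda>z. x / (x - z))) = 1/2"
    using deg by (simp add: b field_simps)
  have re: "Re (x / (x - z)) - 1/2 = ((norm x)\<^sup>2 - 1) / (2 * (norm (x - z))\<^sup>2)"
    if "poly P z = 0" for z
  proof -
    have z: "norm z = 1" "x \<noteq> z" using zeros[OF that] x1 by auto
    then have "norm (x - z) \<noteq> 0" by simp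
    have "(norm (x - z))\<^sup>2 = (norm x)\<^sup>2 + 1 - 2 * Re (x * cnj z)"
    proof -
      have "(Re z)\<^sup>2 + (Im z)\<^sup>2 = 1" using z by (simp flip: cmod_power2)
      then show ?thesis unfolding cmod_power2 by (simp add: power2_eq_square algebra_simps)
    qed
    moreover have "Re (x / (x - z)) = Re (x * cnj (x - z)) / (norm (x - z))\<^sup>2"
      by (simp add: complex_div_cnj[of x])
    moreover have "Re (x * cnj (x - z)) = (norm x)\<^sup>2 - Re (x * cnj z)"
      unfolding cmod_power2 by (simp add: power2_eq_square algebra_simps)
    ultimately show ?thesis using \<open>norm (x - z) \<noteq> 0\<close> by (simp add: field_simps)
  qed
  have pos: "(norm (x - z))\<^sup>2 > 0" if "poly P z = 0" for z
    using zeros[OF that] x1 by auto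
  consider "norm x > 1" | "norm x < 1" using x1 by linarith
  then show False
  proof cases
    case 1
    then have sq: "(norm x)\<^sup>2 - 1 > 0" by (simp add: one_less_power)
    from deg have "Re (zero_mean P (\<lambda>z. 1/2)) < Re (zero_mean P (\<lambda>z. x / (x - z)))"
    proof (rule zero_mean_Re_less)
      fix z assume z: "poly P z = 0"
      have "((norm x)\<^sup>2 - 1) / (2 * (norm (x - z))\<^sup>2) > 0"
        using pos[OF z] sq by (intro divide_pos_pos) auto
      then show "Re (1/2) < Re (x / (x - z))" using re[OF z] by simp
    qed
    then show False using half deg by (simp add: zero_mean_const)
  next
    case 2
    then have sq: "(norm x)\<^sup>2 - 1 < 0" by (simp add: power_less_one_iff abs_square_less_1)
    from deg have "Re (zero_mean P (\<lambda>z. 1/2)) > Re (zero_mean P (\<lambda>z. x / (x - z)))"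
    proof (rule zero_mean_Re_less)
      fix z assume z: "poly P z = 0"
      have "((norm x)\<^sup>2 - 1) / (2 * (norm (x - z))\<^sup>2) < 0"
        using pos[OF z] sq by (intro divide_neg_pos) auto
      then show "Re (1/2) > Re (x / (x - z))" using re[OF z] by simp
    qed
    then show False using half deg by (simp add: zero_mean_const)
  qed
qed

definition pos_real :: "complex set" where "pos_real = of_real ` {0<..}"

lemma pos_real_iff: "z \<in> pos_real \<longleftrightarrow> Im z = 0 \<and> Re z > 0"
  by (auto simp: pos_real_def image_iff complex_eq_iff)

text \<open>Again the average of \<open>x / (x - z)\<close> would have to be the real number \<open>- b / n\<close>. For \<open>z > 0\<close> the imaginary
  part of \<open>x / (x - z)\<close> has the sign opposite to that of \<open>x\<close>, which excludes nonreal \<open>x\<close>; for real \<open>x \<le> 0\<close>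
  the quotient lies in \<open>[0, 1]\<close>, which excludes \<open>b\<close> outside \<open>[- n, 0]\<close>.\<close>
lemma euler_op_zeros_positive:
  assumes deg: "degree P > 0" and b: "b \<notin> {- real (degree P)..0}"
    and zeros: "\<And>z. poly P z = 0 \<Longrightarrow> z \<in> pos_real" and x: "poly (euler_op (of_real b) P) x = 0"
  shows "x \<in> pos_real"
proof (rule ccontr)
  assume x1: "x \<notin> pos_real"
  then have nz: "poly P x \<noteq> 0" using zeros by auto
  then have "of_nat (degree P) * zero_mean P (\<lambda>z. x / (x - z)) + of_real b = 0"
    using poly_euler_op x by fastforce
  then have eq: "zero_mean P (\<lambda>z. x / (x - z)) = of_real (- b / real (degree P))"
    using deg by (simp add: field_simps add_eq_0_iff)
  have im: "Im (x / (x - z)) = - Re z * Im x / (norm (x - z))\<^sup>2" "(norm (x - z))\<^sup>2 > 0" "Re z > 0"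
    if "poly P z = 0" for z
  proof -
    have z: "Im z = 0" "x \<noteq> z" "Re z > 0" using zeros[OF that] x1 by (auto simp: pos_real_iff)
    have "Im (x / (x - z)) = Im (x * cnj (x - z)) / (norm (x - z))\<^sup>2"
      by (simp add: complex_div_cnj[of x])
    also have "Im (x * cnj (x - z)) = - Re z * Im x" using z by (simp add: algebra_simps)
    finally show "Im (x / (x - z)) = - Re z * Im x / (norm (x - z))\<^sup>2" .
    show "(norm (x - z))\<^sup>2 > 0" "Re z > 0" using z by auto
  qed
  have im0: "Re (zero_mean P (\<lambda>z. of_real (Im (x / (x - z))))) = 0"
    by (simp add: eq flip: zero_mean_Im)
  have z0: "zero_mean P (\<lambda>z. 0) = 0" using deg by (simp add: zero_mean_const)
  consider "Im x > 0" | "Im x < 0" | "Im x = 0" by linarith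
  then show False
  proof cases
    case 1
    have "Re (zero_mean P (\<lambda>z. of_real (Im (x / (x - z))))) < Re (zero_mean P (\<lambda>z. 0))"
      by (intro zero_mean_Re_less deg) (use im 1 in \<open>auto intro!: divide_neg_pos simp: mult_neg_pos\<close>)
    then show False using im0 z0 by simp
  next
    case 2
    have "Re (zero_mean P (\<lambda>z. of_real (Im (x / (x - z))))) > Re (zero_mean P (\<lambda>z. 0))"
      by (intro zero_mean_Re_less deg) (use im 2 in \<open>auto intro!: divide_neg_pos mult_pos_neg\<close>)
    then show False using im0 z0 by simp
  next
    case 3
    then have xr: "x = of_real (Re x)" "Re x \<le> 0" using x1 by (auto simp: pos_real_iff complex_eq_iff)
    have rng: "0 \<le> Re (x / (x - z))" "Re (x / (x - z)) \<le> 1" if Pz: "poly P z = 0" for z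
    proof -
      obtain r where z: "z = of_real r" "r > 0" using zeros[OF Pz] by (auto simp: pos_real_def)
      have "x / (x - z) = of_real (Re x / (Re x - r))"
        unfolding z(1) by (subst (1 2) xr(1)) (simp only: of_real_divide of_real_diff)
      then have eq: "Re (x / (x - z)) = Re x / (Re x - r)" by simp
      show "0 \<le> Re (x / (x - z))" "Re (x / (x - z)) \<le> 1"
        using xr(2) z(2) unfolding eq by (auto simp: divide_simps)
    qed
    have "Re (zero_mean P (\<lambda>_. 0)) \<le> Re (zero_mean P (\<lambda>z. x / (x - z)))"
         "Re (zero_mean P (\<lambda>z. x / (x - z))) \<le> Re (zero_mean P (\<lambda>_. 1))"
      using rng by (auto intro!: zero_mean_Re_mono)
    then have "0 \<le> - b / real (degree P)" "- b / real (degree P) \<le> 1"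
      using deg by (simp_all add: eq zero_mean_const)
    then show False using b deg by (auto simp: field_simps)
  qed
qed

text \<open>To the right of all zeros of \<open>P\<close> the quotient \<open>x P' / P\<close> is nonnegative, so \<open>x P' / P + b\<close> cannot vanish.\<close>
lemma euler_op_zeros_le:
  assumes deg: "degree P > 0" and b: "b > 0"
    and zeros: "\<And>z. poly P z = 0 \<Longrightarrow> z \<in> of_real ` {0<..R}"
    and x: "poly (euler_op (of_real b) P) x = 0"
  shows "x \<in> of_real ` {0<..R}"
proof -
  have "z \<in> pos_real" if "poly P z = 0" for z using zeros[OF that] by (auto simp: pos_real_def)
  then have "x \<in> pos_real" using euler_op_zeros_positive[OF deg _ _ x] b by auto
  then obtain r where r: "x = of_real r" "r > 0" by (auto simp: pos_real_def)
  have "r \<le> R"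
  proof (rule ccontr)
    assume rR: "\<not> r \<le> R"
    then have "poly P x \<noteq> 0" using zeros[of x] r by auto
    then have "of_nat (degree P) * zero_mean P (\<lambda>z. x / (x - z)) + of_real b = 0"
      using poly_euler_op x by fastforce
    then have eq: "zero_mean P (\<lambda>z. x / (x - z)) = of_real (- b / real (degree P))"
      using deg by (simp add: field_simps add_eq_0_iff)
    have "Re (zero_mean P (\<lambda>_. 0)) \<le> Re (zero_mean P (\<lambda>z. x / (x - z)))"
    proof (rule zero_mean_Re_mono)
      fix z assume "poly P z = 0"
      from zeros[OF this] obtain s where z: "z = of_real s" "0 < s" "s \<le> R" by auto
      then have "x / (x - z) = of_real (r / (r - s))" by (simp add: r)
      then show "Re 0 \<le> Re (x / (x - z))" using z r rR by simp
    qed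
    then show False using deg b by (auto simp: eq zero_mean_const field_simps)
  qed
  then show ?thesis using r by auto
qed

text \<open>For \<open>b = - B n\<close> with \<open>B > 1\<close> the zeros move to the right, and the largest one is controlled through a
  point \<open>t\<close> with \<open>1 / t\<close> to the right of all zeros and \<open>\<psi> t \<le> y < B - 1\<close>. The factor \<open>1 - B + \<psi>\<close> that the
  operator introduces has no zero on \<open>(0, t]\<close> because \<open>\<psi>\<close> increases there, so \<open>1 / t\<close> remains to the right
  of the new zeros. The step increases \<open>\<psi>\<close>, but convexity of \<open>\<psi>\<close> bounds the increase at the smaller
  point \<open>t'\<close> by \<open>\<psi> t - \<psi> t'\<close>; for this \<open>t / t' - 1\<close> is taken to be
  \<open>1 / (n (B - 1 - y))\<close>. So \<open>(t', y)\<close> is again such a pair.\<close>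
lemma euler_op_zeros_barrier:
  assumes deg: "degree P > 0" and b: "b = - B * real (degree P)" and B: "0 < y" "y < B - 1"
    and zeros: "\<And>z. poly P z = 0 \<Longrightarrow> z \<in> of_real ` {0<..<1/t}" and t: "t > 0"
    and psi: "Re (zero_psi P (of_real t)) \<le> y"
    and t': "t' = t / (1 + 1 / (real (degree P) * (B - 1 - y)))"
  shows "\<forall>x. poly (euler_op (of_real b) P) x = 0 \<longrightarrow> x \<in> of_real ` {0<..<1/t}"
    and "Re (zero_psi (euler_op (of_real b) P) (of_real t')) \<le> y" "0 < t'" "t' \<le> t"
proof -
  define n where "n = real (degree P)"
  have n: "n > 0" using deg by (simp add: n_def)
  have c: "0 < 1 / (n * (B - 1 - y))" using n B by simp
  show t'0: "0 < t'" and t't: "t' \<le> t"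
  proof -
    have "0 < t / (1 + d) \<and> t / (1 + d) \<le> t" if "0 < d" for d
      using t that by (auto simp: field_simps)
    from this[OF c] show "0 < t'" "t' \<le> t" by (auto simp: t' n_def)
  qed
  have z_pos: "z \<in> pos_real" if "poly P z = 0" for z using zeros[OF that] by (auto simp: pos_real_def)
  have real: "z \<in> \<real>" if "poly P z = 0" for z using zeros[OF that] by auto
  have psi_real: "zero_psi P (of_real s) = of_real (Re (zero_psi P (of_real s)))" for s
    unfolding zero_psi_def by (rule zero_mean_of_real[symmetric]) (intro Reals_divide Reals_mult Reals_diff; simp add: real)
  have zt: "\<exists>s. z = of_real s \<and> 0 < s \<and> (\<forall>r. r \<le> t \<longrightarrow> s * r < 1)" if Pz: "poly P z = 0" for z
  proof -
    from zeros[OF Pz] obtain s where s: "z = of_real s" "0 < s" "s < 1/t" by auto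
    have "s * r < 1" if "r \<le> t" for r
    proof -
      have "s * r \<le> s * t" using s that by simp
      also have "\<dots> < 1" using s t by (simp add: field_simps)
      finally show ?thesis .
    qed
    with s show ?thesis by blast
  qed
  have mono: "Re (zero_psi P (of_real r)) \<le> y" if r: "0 < r" "r \<le> t" for r
  proof -
    have "Re (zero_psi P (of_real r)) \<le> Re (zero_psi P (of_real t))"
      unfolding zero_psi_def
    proof (rule zero_mean_Re_mono)
      fix z assume "poly P z = 0"
      from zt[OF this] r obtain s where s: "z = of_real s" "0 < s" "s * r < 1" "s * t < 1" by auto
      have "s * r / (1 - s * r) \<le> s * t / (1 - s * t)"
        using s r by (intro frac_le) auto
      moreover have "z * of_real u / (1 - z * of_real u) = of_real (s * u / (1 - s * u))" for u
        by (simp add: s)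
      ultimately show "Re (z * of_real r / (1 - z * of_real r)) \<le> Re (z * of_real t / (1 - z * of_real t))"
        by (simp only: Re_complex_of_real)
    qed
    with psi show ?thesis by simp
  qed
  have bn: "b \<notin> {- real (degree P)..0}"
    using B n by (auto simp: b n_def)
  define q where "q = 1 + complex_of_real b / of_nat (degree P)"
  have q: "q = of_real (1 - B)" using n by (simp add: q_def b n_def)
  have q0: "q \<noteq> 0" using B unfolding q of_real_eq_0_iff by simp
  have nz: "q + zero_psi P (of_real r) \<noteq> 0" if "0 < r" "r \<le> t" for r
  proof -
    have "Re (q + zero_psi P (of_real r)) < 0" using mono[OF that] B by (simp add: q)
    then show ?thesis by (metis less_irrefl zero_complex.sel(1))
  qed
  have notroot: "poly P (1 / of_real r) \<noteq> 0" if r: "0 < r" "r \<le> t" for r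
  proof
    assume "poly P (1 / of_real r) = 0"
    from zt[OF this] r obtain s where "1 / of_real r = complex_of_real s" "s * r < 1" by auto
    then have "1 / r = s" by (metis of_real_1 of_real_divide of_real_eq_iff)
    then show False using \<open>s * r < 1\<close> r by auto
  qed
  show "\<forall>x. poly (euler_op (of_real b) P) x = 0 \<longrightarrow> x \<in> of_real ` {0<..<1/t}"
  proof (intro allI impI)
    fix x assume x: "poly (euler_op (of_real b) P) x = 0"
    have "x \<in> pos_real" using euler_op_zeros_positive[OF deg bn z_pos x] .
    then obtain s where s: "x = of_real s" "s > 0" by (auto simp: pos_real_def)
    have "s < 1/t"
    proof (rule ccontr)
      assume "\<not> s < 1/t"
      then have r: "0 < 1/s" "1/s \<le> t" using s t by (auto simp: field_simps)
      have nr: "poly P x \<noteq> 0" using notroot[OF r] s by simp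
      have "poly (euler_op (of_real b) P) x = poly P x * (of_nat (degree P) * (q + zero_psi P (of_real (1/s))))"
        using poly_euler_op[OF nr] zero_mean_eq_zero_psi[OF deg _ nr] s deg
        by (simp add: q_def field_simps)
      then show False using x nz[OF r] nr deg by simp
    qed
    with s show "x \<in> of_real ` {0<..<1/t}" by auto
  qed
  define D where "D = Re (zero_psi' P (of_real t'))"
  have D_real: "zero_psi' P (of_real t') = of_real D"
    unfolding zero_psi'_def D_def
    by (rule zero_mean_of_real[symmetric]) (intro Reals_divide Reals_mult Reals_diff Reals_power; simp add: real)
  define k where "k = t / t' - 1"
  \<comment> \<open>The tangent inequality for \<open>\<psi>\<close> at \<open>t'\<close>; recall that \<open>D\<close> is \<open>t' * \<psi>' t'\<close>.\<close>
  have convex: "Re (zero_psi P (of_real t')) + D * k \<le> Re (zero_psi P (of_real t))"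
  proof -
    have "Re (zero_mean P (\<lambda>z. z * of_real t' / (1 - z * of_real t') + of_real k * (z * of_real t' / (1 - z * of_real t')\<^sup>2)))
      \<le> Re (zero_psi P (of_real t))" unfolding zero_psi_def
    proof (rule zero_mean_Re_mono)
      fix z assume "poly P z = 0"
      from zt[OF this] t't obtain s where s: "z = of_real s" "0 < s" "s * t' < 1" "s * t < 1" by auto
      have "s * t' / (1 - s * t') + k * (s * t' / (1 - s * t')\<^sup>2)
         = s * t' / (1 - s * t') + (s * (t - t')) / ((1 - s * t') * (1 - s * t'))"
      proof -
        have "k * (s * t') = s * (t - t')" using t'0 by (simp add: k_def field_simps)
        then show ?thesis by (simp add: power2_eq_square)
      qed
      also have "\<dots> \<le> s * t' / (1 - s * t') + (s * (t - t')) / ((1 - s * t') * (1 - s * t))"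
        using s t't by (intro add_left_mono divide_left_mono mult_left_mono mult_nonneg_nonneg mult_pos_pos) auto
      also have "\<dots> = s * t / (1 - s * t)"
      proof -
        have "(1 - u) / u + (u - v) / (u * v) = (1 - v) / v" if "u > 0" "v > 0" for u v :: real
          using that by (simp add: field_simps)
        from this[of "1 - s * t'" "1 - s * t"] show ?thesis using s by (simp add: algebra_simps)
      qed
      finally have le: "s * t' / (1 - s * t') + k * (s * t' / (1 - s * t')\<^sup>2) \<le> s * t / (1 - s * t)" .
      have 1: "z * of_real t / (1 - z * of_real t) = of_real (s * t / (1 - s * t))"
        by (simp add: s)
      have 2: "z * of_real t' / (1 - z * of_real t') + of_real k * (z * of_real t' / (1 - z * of_real t')\<^sup>2)
         = of_real (s * t' / (1 - s * t') + k * (s * t' / (1 - s * t')\<^sup>2))"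
        by (simp add: s)
      show "Re (z * of_real t' / (1 - z * of_real t') + of_real k * (z * of_real t' / (1 - z * of_real t')\<^sup>2))
        \<le> Re (z * of_real t / (1 - z * of_real t))"
        unfolding 1 2 using le by (simp only: Re_complex_of_real)
    qed
    moreover have "zero_mean P (\<lambda>z. z * of_real t' / (1 - z * of_real t') + of_real k * (z * of_real t' / (1 - z * of_real t')\<^sup>2))
      = zero_psi P (of_real t') + of_real k * zero_psi' P (of_real t')"
      unfolding zero_mean_add zero_mean_cmult zero_psi_def zero_psi'_def ..
    ultimately show ?thesis by (simp add: D_real algebra_simps)
  qed
  have D0: "D \<ge> 0"
  proof -
    have "Re (zero_mean P (\<lambda>_. 0)) \<le> D" unfolding D_def zero_psi'_def
    proof (rule zero_mean_Re_mono)
      fix z assume "poly P z = 0"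
      from zt[OF this] t't obtain s where s: "z = of_real s" "0 < s" "s * t' < 1" by auto
      have "z * of_real t' / (1 - z * of_real t')\<^sup>2 = of_real (s * t' / (1 - s * t')\<^sup>2)" by (simp add: s)
      then show "Re 0 \<le> Re (z * of_real t' / (1 - z * of_real t')\<^sup>2)"
        using s t'0 by (simp only: Re_complex_of_real) simp
    qed
    then show ?thesis using deg by (simp add: zero_mean_const)
  qed
  have tt: "k = 1 / (n * (B - 1 - y))"
    using c t by (simp add: k_def t' n_def[symmetric])
  define p where "p = Re (zero_psi P (of_real t'))"
  have p: "zero_psi P (of_real t') = of_real p" unfolding p_def by (rule psi_real)
  have py: "p \<le> y" using mono[OF t'0 t't] by (simp add: p_def)
  have "zero_psi (euler_op (of_real b) P) (of_real t') =
     zero_psi P (of_real t') - zero_psi' P (of_real t') / (of_nat (degree P) * (q + zero_psi P (of_real t')))"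
    by (rule zero_psi_euler_op[OF deg q_def q0]) (use t'0 t't notroot nz in auto)
  also have "\<dots> = of_real (p - D / (n * ((1 - B) + p)))"
    by (simp add: D_real p q n_def)
  finally have "Re (zero_psi (euler_op (of_real b) P) (of_real t')) = p - D / (n * ((1 - B) + p))"
    by simp
  also have "\<dots> = p + D * (1 / (n * (B - 1 - p)))"
  proof -
    have "n * ((1 - B) + p) = - (n * (B - 1 - p))" by (simp add: algebra_simps)
    then show ?thesis by simp
  qed
  also have "\<dots> \<le> p + D * (1 / (n * (B - 1 - y)))"
    using n B py D0 by (intro add_left_mono mult_left_mono divide_left_mono mult_pos_pos) auto
  also have "\<dots> \<le> y" using convex psi tt by (simp add: p_def)
  finally show "Re (zero_psi (euler_op (of_real b) P) (of_real t')) \<le> y" .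
qed

section \<open>Discrete characteristics\<close>

lemma norm_le_half_bounds:
  fixes w :: complex
  assumes "norm w \<le> 1/2"
  shows "norm (1 / (1 - w)) \<le> 2" "1 - w \<noteq> 0"
proof -
  have "norm (1 - w) \<ge> 1/2" using assms norm_triangle_ineq2[of 1 w] by simp
  then have "norm (1 - w) > 0" "1 \<le> 2 * norm (1 - w)" by linarith+
  then show "norm (1 / (1 - w)) \<le> 2" "1 - w \<noteq> 0"
    by (auto simp: norm_divide divide_le_eq)
qed

lemma tendsto_one_plus_power_exp:
  fixes a :: "nat \<Rightarrow> complex"
  assumes a: "a \<longlonglongrightarrow> 0" and ca: "(\<lambda>n. of_nat (c n) * a n) \<longlonglongrightarrow> L"
  shows "(\<lambda>n. (1 + a n) ^ c n) \<longlonglongrightarrow> exp L"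
proof -
  have small: "eventually (\<lambda>n. norm (a n) < 1/2) sequentially"
    using tendstoD[OF a, of "1/2"] by simp
  have "(\<lambda>n. of_nat (c n) * ln (1 + a n) - of_nat (c n) * a n) \<longlonglongrightarrow> 0"
  proof (rule Lim_null_comparison)
    show "(\<lambda>n. norm (of_nat (c n) * a n) * (2 * norm (a n))) \<longlonglongrightarrow> 0"
      by (rule tendsto_eq_intros ca a refl | simp)+
    show "eventually (\<lambda>n. norm (of_nat (c n) * ln (1 + a n) - of_nat (c n) * a n)
        \<le> norm (of_nat (c n) * a n) * (2 * norm (a n))) sequentially"
      using small
    proof eventually_elim
      case (elim n)
      have "norm (ln (1 + a n) - a n) \<le> (norm (a n))\<^sup>2 / (1 - norm (a n))"
        using elim by (intro Ln_approx_linear) auto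
      also have "\<dots> \<le> (norm (a n))\<^sup>2 / (1/2)"
        using elim by (intro divide_left_mono) auto
      finally have "real (c n) * norm (ln (1 + a n) - a n) \<le> real (c n) * (2 * (norm (a n))\<^sup>2)"
        by (intro mult_left_mono) auto
      moreover have "norm (of_nat (c n) * ln (1 + a n) - of_nat (c n) * a n) =
          real (c n) * norm (ln (1 + a n) - a n)"
        by (simp only: norm_mult norm_of_nat flip: right_diff_distrib)
      ultimately show ?case
        by (simp add: norm_mult power2_eq_square mult_ac)
    qed
  qed
  from tendsto_add[OF this ca] have "(\<lambda>n. of_nat (c n) * ln (1 + a n)) \<longlonglongrightarrow> L" by simp
  then have "(\<lambda>n. exp (of_nat (c n) * ln (1 + a n))) \<longlonglongrightarrow> exp L" by (rule tendsto_exp)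
  moreover have "eventually (\<lambda>n. exp (of_nat (c n) * ln (1 + a n)) = (1 + a n) ^ c n) sequentially"
    using small
  proof eventually_elim
    case (elim n)
    have "1 + a n \<noteq> 0" using norm_le_half_bounds(2)[of "- a n"] elim by simp
    then show ?case by (simp add: exp_of_nat_mult)
  qed
  ultimately show ?thesis by (rule Lim_transform_eventually)
qed

lemma norm_zero_psi_le:
  assumes "degree P > 0" "\<And>z. poly P z = 0 \<Longrightarrow> norm z \<le> R" "R * norm t \<le> 1/2"
  shows "norm (zero_psi P t) \<le> 2 * (R * norm t)"
  unfolding zero_psi_def
proof (rule norm_zero_mean_le)
  fix z assume "poly P z = 0"
  then have zt: "norm (z * t) \<le> R * norm t" using assms(2)[of z] by (simp add: norm_mult mult_right_mono)
  have "norm (z * t / (1 - z * t)) = norm (z * t) * norm (1 / (1 - z * t))"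
    by (simp add: norm_mult norm_divide)
  also have "\<dots> \<le> (R * norm t) * 2"
    using zt assms(3) norm_le_half_bounds[of "z * t"] by (intro mult_mono) (auto intro: order.trans[OF norm_ge_zero])
  finally show "norm (z * t / (1 - z * t)) \<le> 2 * (R * norm t)" by simp
qed (rule assms)

lemma zero_psi_lipschitz:
  assumes "degree P > 0" "\<And>z. poly P z = 0 \<Longrightarrow> norm z \<le> R" "R * norm s \<le> 1/2" "R * norm t \<le> 1/2"
  shows "norm (zero_psi P s - zero_psi P t) \<le> 4 * R * norm (s - t)"
  unfolding zero_psi_def zero_mean_diff[symmetric]
proof (rule norm_zero_mean_le)
  fix z assume Pz: "poly P z = 0"
  have R: "norm z \<le> R" using assms(2)[OF Pz] .
  have zs: "norm (z * s) \<le> 1/2" "norm (z * t) \<le> 1/2"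
    using assms(3,4) mult_right_mono[OF R, of "norm s"] mult_right_mono[OF R, of "norm t"]
    by (auto simp: norm_mult)
  have "z * s / (1 - z * s) - z * t / (1 - z * t) = z * (s - t) * (1 / (1 - z * s)) * (1 / (1 - z * t))"
    using norm_le_half_bounds(2)[OF zs(1)] norm_le_half_bounds(2)[OF zs(2)]
    by (simp add: divide_simps) (simp add: algebra_simps)
  then have "norm (z * s / (1 - z * s) - z * t / (1 - z * t)) =
      norm z * norm (s - t) * norm (1 / (1 - z * s)) * norm (1 / (1 - z * t))"
    by (simp only: norm_mult)
  also have "\<dots> \<le> R * norm (s - t) * 2 * 2"
    using norm_le_half_bounds(1)[OF zs(1)] norm_le_half_bounds(1)[OF zs(2)] R order.trans[OF norm_ge_zero R]
    by (intro mult_mono) auto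
  finally show "norm (z * s / (1 - z * s) - z * t / (1 - z * t)) \<le> 4 * R * norm (s - t)" by simp
qed (rule assms)

text \<open>The point moves from \<open>t\<close> to \<open>t' = t / (1 - a)\<close>, a discrete form of multiplication by the exponential of
  \<open>a = 1 / (n (q + y))\<close>; with this form \<open>\<psi> t' - \<psi> t\<close> differs from \<open>a t' \<psi>' t'\<close> by an explicit multiple
  of \<open>a\<^sup>2\<close>. The evolution step subtracts \<open>t' \<psi>' t' / (n (q + \<psi> t'))\<close>, which cancels \<open>a t' \<psi>' t'\<close> up to a
  term of order \<open>\<bar>\<psi> t' - y\<bar> / n\<close>.\<close>
lemma characteristic_step_error:
  assumes deg: "degree P > 0" and n: "n = real (degree P)" and q: "q = 1 + b / of_nat (degree P)"
    and t'0: "t' \<noteq> 0"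
    and half: "\<And>z. poly P z = 0 \<Longrightarrow> norm (z * t') \<le> 1/2" "\<And>z. poly P z = 0 \<Longrightarrow> norm (z * t) \<le> 1/2"
    and a: "a = 1 / (of_real n * (q + y))" and t: "t = t' * (1 - a)"
    and q0: "q0 > 0" "norm (q + y) \<ge> q0" "norm (q + zero_psi P t') \<ge> q0" "norm q \<ge> q0"
  shows "norm (zero_psi (euler_op b P) t' - y) \<le> norm (zero_psi P t - y) * (1 + 2 / q0\<^sup>2 / n)
     + (2 / q0\<^sup>2 + 2 / q0\<^sup>2 * (2 / q0 + 2 / q0\<^sup>2)) / n\<^sup>2"
proof -
  define D where "D = zero_psi' P t'"
  define h where "h = 1 / n"
  have n1: "n \<ge> 1" using deg by (simp add: n)
  have h: "h > 0" "h \<le> 1" using n1 by (simp_all add: h_def)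
  have nz: "q \<noteq> 0" "q + y \<noteq> 0" "q + zero_psi P t' \<noteq> 0" using q0 by auto
  have "poly P (1 / t') \<noteq> 0"
    using half(1)[of "1/t'"] t'0 by auto
  then have rec: "zero_psi (euler_op b P) t' = zero_psi P t' - D / (of_nat (degree P) * (q + zero_psi P t'))"
    unfolding D_def by (intro zero_psi_euler_op deg q nz t'0)
  have na: "norm a \<le> h / q0"
    using q0 n1 unfolding a h_def by (simp add: norm_divide norm_mult frac_le)
  have D: "norm D \<le> 2"
    unfolding D_def zero_psi'_def
  proof (rule norm_zero_mean_le)
    fix z assume z: "poly P z = 0"
    have "norm (z * t' / (1 - z * t')\<^sup>2) = norm (z * t') * norm (1 / (1 - z * t')) * norm (1 / (1 - z * t'))"
      by (simp add: norm_mult norm_divide power2_eq_square)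
    also have "\<dots> \<le> 1/2 * 2 * 2"
      using half(1)[OF z] norm_le_half_bounds(1)[OF half(1)[OF z]] by (intro mult_mono) auto
    finally show "norm (z * t' / (1 - z * t')\<^sup>2) \<le> 2" by simp
  qed (rule deg)
  define E where "E = zero_psi P t' - zero_psi P t - a * D"
  have E: "norm E \<le> 2 * (norm a)\<^sup>2"
  proof -
    have "E = zero_mean P (\<lambda>z. z * t' / (1 - z * t') - z * t / (1 - z * t) - a * (z * t' / (1 - z * t')\<^sup>2))"
      unfolding E_def D_def zero_psi_def zero_psi'_def zero_mean_diff zero_mean_cmult ..
    also have "norm \<dots> \<le> 2 * (norm a)\<^sup>2"
    proof (rule norm_zero_mean_le)
      fix z assume z: "poly P z = 0"
      define w where "w = z * t'"
      have w: "z * t = w * (1 - a)" by (simp add: w_def t)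
      have bd: "norm w \<le> 1/2" "norm (w * (1 - a)) \<le> 1/2"
        using half(1)[OF z] half(2)[OF z] by (simp_all add: w w_def[symmetric])
      \<comment> \<open>The three terms share the denominators \<open>u = 1 - z t'\<close> and \<open>v = 1 - z t\<close>, and \<open>z t' a = v - u\<close>.\<close>
      define u v where "u = 1 - w" and "v = 1 - w * (1 - a)"
      have uv: "u \<noteq> 0" "v \<noteq> 0" "norm (1/u) \<le> 2" "norm (1/v) \<le> 2"
        using norm_le_half_bounds[OF bd(1)] norm_le_half_bounds[OF bd(2)] by (auto simp: u_def v_def)
      have wa: "w * a = v - u" "w = 1 - u" "w * (1 - a) = 1 - v" by (simp_all add: u_def v_def algebra_simps)
      have "w / u - w * (1 - a) / v - a * (w / u\<^sup>2) = (1 - u) / u - (1 - v) / v - (v - u) / u\<^sup>2"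
        using wa by (simp add: mult.commute)
      also have "\<dots> = - ((v - u) * (v - u)) * (1/u) * (1/u) * (1/v)"
        using uv by (simp add: divide_simps power2_eq_square) (simp add: algebra_simps)
      also have "norm \<dots> = (norm w * norm a) * (norm w * norm a) * norm (1/u) * norm (1/u) * norm (1/v)"
        by (simp only: norm_mult norm_minus_cancel flip: wa(1))
      also have "\<dots> \<le> (1/2 * norm a) * (1/2 * norm a) * 2 * 2 * 2"
        using bd uv by (intro mult_mono mult_nonneg_nonneg) auto
      finally show "norm (z * t' / (1 - z * t') - z * t / (1 - z * t) - a * (z * t' / (1 - z * t')\<^sup>2)) \<le> 2 * (norm a)\<^sup>2"
        unfolding w w_def[symmetric] u_def v_def by (simp add: power2_eq_square)
    qed (rule deg)
    finally show ?thesis .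
  qed
  have psi': "zero_psi P t' = zero_psi P t + a * D + E" by (simp add: E_def)
  define e where "e = norm (zero_psi P t - y)"
  have dist': "norm (zero_psi P t' - y) \<le> e + 2 * (h/q0) + 2 * (h/q0)\<^sup>2"
  proof -
    have "norm (zero_psi P t' - y) \<le> e + norm a * norm D + norm E"
      unfolding psi' e_def norm_mult[symmetric] by (metis (no_types, lifting) add.assoc add_diff_eq add_right_mono diff_add_eq norm_triangle_ineq norm_triangle_le order_refl)
    also have "\<dots> \<le> e + (h/q0) * 2 + 2 * (h/q0)\<^sup>2"
      using na D E h q0 by (intro add_mono mult_mono order.trans[OF E] mult_left_mono power_mono) auto
    finally show ?thesis by (simp add: mult.commute)
  qed
  have hn: "of_real h = 1 / (of_nat (degree P) :: complex)" by (simp add: h_def n)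
  have "zero_psi (euler_op b P) t' - y = (zero_psi P t - y) + E + (a * D - of_real h * D / (q + zero_psi P t'))"
    unfolding rec hn by (simp add: psi')
  also have "a * D - of_real h * D / (q + zero_psi P t') =
     of_real h * D * (zero_psi P t' - y) * (1 / (q + y)) * (1 / (q + zero_psi P t'))"
    using nz n1 by (simp add: a h_def divide_simps) (simp add: algebra_simps)
  finally have "norm (zero_psi (euler_op b P) t' - y) \<le>
     e + norm E + norm (of_real h * D * (zero_psi P t' - y) * (1 / (q + y)) * (1 / (q + zero_psi P t')))"
    unfolding e_def by (metis (no_types, lifting) add_mono norm_triangle_le order_refl)
  also have "norm (of_real h * D * (zero_psi P t' - y) * (1 / (q + y)) * (1 / (q + zero_psi P t')))
    = h * norm D * norm (zero_psi P t' - y) * norm (1 / (q + y)) * norm (1 / (q + zero_psi P t'))"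
    unfolding norm_mult using h by simp
  also have "e + norm E + \<dots> \<le> e + 2 * (h/q0)\<^sup>2 + h * 2 * (e + 2 * (h/q0) + 2 * (h/q0)\<^sup>2) * (1/q0) * (1/q0)"
  proof (intro add_mono mult_mono)
    show "norm E \<le> 2 * (h/q0)\<^sup>2"
      using na by (intro order.trans[OF E] mult_left_mono power_mono) auto
  qed (use h D dist' q0 in \<open>auto simp: norm_divide e_def divide_simps\<close>)
  also have "\<dots> = e * (1 + 2 / q0\<^sup>2 * h) + (2 / q0\<^sup>2 + 2 / q0\<^sup>2 * (2 / q0 + 2 / q0\<^sup>2 * h)) * h\<^sup>2"
    using q0(1) by (simp add: field_simps power2_eq_square)
  also have "\<dots> \<le> e * (1 + 2 / q0\<^sup>2 * h) + (2 / q0\<^sup>2 + 2 / q0\<^sup>2 * (2 / q0 + 2 / q0\<^sup>2 * 1)) * h\<^sup>2"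
    using q0(1) h by (intro add_left_mono mult_right_mono mult_left_mono) auto
  finally show ?thesis by (simp add: e_def h_def power_one_over)
qed

lemma mult_laguerre_0: "mult_laguerre n b 0 = [:-1, 1:] ^ n"
  by (simp add: mult_laguerre_def)

lemma mult_laguerre_Suc: "mult_laguerre n b (Suc c) = euler_op b (mult_laguerre n b c)"
  by (simp add: mult_laguerre_def)

lemma degree_mult_laguerre:
  assumes "of_nat n + b \<noteq> 0"
  shows "degree (mult_laguerre n b c) = n"
proof (induction c)
  case 0
  show ?case by (simp add: mult_laguerre_0 degree_linear_power)
next
  case (Suc c)
  then show ?case using degree_euler_op[of "mult_laguerre n b c" b] assms
    by (simp add: mult_laguerre_Suc)
qed

lemma mult_laguerre_0_root: "n > 0 \<Longrightarrow> poly (mult_laguerre n b 0) z = 0 \<longleftrightarrow> z = 1"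
  by (auto simp: mult_laguerre_0)

lemma zero_psi_mult_laguerre_0:
  assumes "n > 0"
  shows "zero_psi (mult_laguerre n b 0) t = t / (1 - t)"
proof -
  have "zero_psi (mult_laguerre n b 0) t = zero_mean (mult_laguerre n b 0) (\<lambda>_. t / (1 - t))"
    unfolding zero_psi_def by (rule zero_mean_cong) (simp add: mult_laguerre_0_root[OF assms])
  then show ?thesis
    using assms by (simp add: zero_mean_const mult_laguerre_0 degree_linear_power)
qed

text \<open>Gronwall's argument for the step error. Initially the error vanishes, as \<open>t / (1 - t) = y\<close> for
  \<open>t = y / (1 + y)\<close>. The bounds on \<open>y\<close> keep the whole discrete characteristic within the disc of radius
  \<open>r\<close>, where \<open>\<psi>\<close> is at most \<open>q0\<close> in absolute value and the denominators stay away from zero.\<close>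
lemma characteristic_error:
  fixes b y :: complex and q0 R r \<Gamma> :: real and n C :: nat
  defines "q \<equiv> 1 + b / of_nat n"
  defines "a \<equiv> 1 / (of_nat n * (q + y))"
  defines "t \<equiv> (\<lambda>c. y / (1 + y) / (1 - a) ^ c)"
  defines "L \<equiv> 2 / q0\<^sup>2" and "K \<equiv> 2 / q0\<^sup>2 + 2 / q0\<^sup>2 * (2 / q0 + 2 / q0\<^sup>2)"
  assumes n: "n > 0" and q0: "q0 > 0" "norm q \<ge> 2 * q0" "2 \<le> real n * q0"
    and R: "R > 0" and roots: "\<And>c z. c \<le> C \<Longrightarrow> poly (mult_laguerre n b c) z = 0 \<Longrightarrow> norm z \<le> R"
    and C: "real C \<le> \<Gamma> * real n" and r: "R * r \<le> 1/2" "2 * R * r \<le> q0"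
    and y: "y \<noteq> 0" "norm y \<le> 1/2" "norm y \<le> q0" "2 * norm y * exp (2 * \<Gamma> / q0) \<le> r"
  shows "norm (zero_psi (mult_laguerre n b C) (t C) - y) \<le> K * real C / (real n)\<^sup>2 * (1 + L / real n) ^ C"
    and "norm (t C) \<le> r"
proof -
  have qy: "norm (q + y) \<ge> q0" using q0 y norm_triangle_ineq2[of q "- y"] by simp
  have na: "norm a \<le> 1 / (real n * q0)"
    unfolding a_def using qy q0 n by (simp add: norm_divide norm_mult frac_le)
  also have "\<dots> \<le> 1/2" using q0 n by (simp add: field_simps)
  finally have a2: "norm a \<le> 1/2" .
  have q_nz: "of_nat n + b \<noteq> 0"
  proof
    assume "of_nat n + b = 0"
    then have "b = - of_nat n" by (simp add: add_eq_0_iff)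
    then have "q = 0" using n by (simp add: q_def)
    then show False using q0 by simp
  qed
  have deg: "degree (mult_laguerre n b c) = n" for c by (rule degree_mult_laguerre[OF q_nz])
  have a1: "1 - a \<noteq> 0" using norm_le_half_bounds[OF a2] by simp
  have y1: "1 + y \<noteq> 0" "norm (1 / (1 + y)) \<le> 2" using norm_le_half_bounds[of "- y"] y by auto
  have t0: "t c \<noteq> 0" for c using a1 y1 y by (simp add: t_def)
  have tr: "norm (t c) \<le> r" if "c \<le> C" for c
  proof -
    have "norm (1 / (1 - a)) \<le> 1 + 2 * norm a"
    proof -
      have "1 / (1 - a) = 1 + a * (1 / (1 - a))" using a1 by (simp add: field_simps)
      then have "norm (1 / (1 - a)) \<le> 1 + norm a * norm (1 / (1 - a))"
        by (metis norm_mult norm_one norm_triangle_ineq)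
      also have "\<dots> \<le> 1 + norm a * 2" using norm_le_half_bounds(1)[OF a2] by (intro add_left_mono mult_left_mono) auto
      finally show ?thesis by simp
    qed
    also have "\<dots> \<le> exp (2 * norm a)" by (rule exp_ge_add_one_self)
    also have "\<dots> \<le> exp (2 / (real n * q0))" using na by simp
    finally have 1: "norm (1 / (1 - a)) \<le> exp (2 / (real n * q0))" .
    have "norm (t c) = norm y * norm (1 / (1 + y)) * norm (1 / (1 - a)) ^ c"
      by (simp add: t_def norm_mult norm_divide norm_power power_one_over)
    also have "\<dots> \<le> norm y * 2 * exp (2 / (real n * q0)) ^ c"
      using y1 1 by (intro mult_mono power_mono) auto
    also have "exp (2 / (real n * q0)) ^ c = exp (real c * (2 / (real n * q0)))"
      by (rule exp_of_nat_mult[symmetric])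
    also have "norm y * 2 * \<dots> \<le> norm y * 2 * exp (2 * \<Gamma> / q0)"
    proof -
      have "real c * 2 \<le> \<Gamma> * real n * 2" using that C by simp
      then have "real c * (2 / (real n * q0)) \<le> 2 * \<Gamma> / q0"
        using n q0 by (simp add: field_simps)
      then show ?thesis by (intro mult_left_mono) auto
    qed
    finally show ?thesis using y(4) by (simp add: mult_ac)
  qed
  then show "norm (t C) \<le> r" by simp
  have K: "K \<ge> 0" "L \<ge> 0" using q0 by (auto simp: K_def L_def)
  have "norm (zero_psi (mult_laguerre n b c) (t c) - y) \<le> K * real c / (real n)\<^sup>2 * (1 + L / real n) ^ c"
    if "c \<le> C" for c using that
  proof (induction c)
    case 0
    have "t 0 / (1 - t 0) = y" using y1 by (simp add: t_def field_simps)
    then show ?case by (simp add: zero_psi_mult_laguerre_0[OF n])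
  next
    case (Suc c)
    define P where "P = mult_laguerre n b c"
    have Rr: "R * norm (t d) \<le> 1/2" "2 * (R * norm (t d)) \<le> q0" if "d \<le> C" for d
    proof -
      have "R * norm (t d) \<le> R * r" using tr[OF that] R by (intro mult_left_mono) auto
      then show "R * norm (t d) \<le> 1/2" "2 * (R * norm (t d)) \<le> q0" using r by linarith+
    qed
    have rt: "norm z \<le> R" if "poly P z = 0" for z using roots[of c z] that Suc.prems by (simp add: P_def)
    have half: "norm (z * t d) \<le> 1/2" if "poly P z = 0" "d \<le> C" for z d
      using Rr(1)[OF that(2)] mult_right_mono[OF rt[OF that(1)], of "norm (t d)"] by (simp add: norm_mult)
    have "norm (zero_psi P (t (Suc c))) \<le> 2 * (R * norm (t (Suc c)))"
      using rt Rr(1)[OF Suc.prems] n by (intro norm_zero_psi_le) (auto simp: P_def deg)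
    also have "\<dots> \<le> q0" using Rr(2)[OF Suc.prems] .
    finally have qpsi: "norm (q + zero_psi P (t (Suc c))) \<ge> q0"
      using q0 norm_triangle_ineq2[of q "- zero_psi P (t (Suc c))"] by simp
    have tS: "t c = t (Suc c) * (1 - a)" using a1 by (simp add: t_def)
    have "norm (zero_psi (euler_op b P) (t (Suc c)) - y) \<le>
      norm (zero_psi P (t c) - y) * (1 + 2 / q0\<^sup>2 / real n) + (2 / q0\<^sup>2 + 2 / q0\<^sup>2 * (2 / q0 + 2 / q0\<^sup>2)) / (real n)\<^sup>2"
    proof (rule characteristic_step_error[where q = q and a = a])
      show "norm (z * t (Suc c)) \<le> 1/2" "norm (z * t c) \<le> 1/2" if "poly P z = 0" for z
        using half[OF that] Suc.prems by auto
      show "norm q \<ge> q0" using q0 by simp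
    qed (use n q0(1) qy qpsi t0 tS in \<open>simp_all add: P_def deg q_def a_def\<close>)
    also have "\<dots> = norm (zero_psi P (t c) - y) * (1 + L / real n) + K / (real n)\<^sup>2"
      by (simp add: K_def L_def)
    also have "\<dots> \<le> (K * real c / (real n)\<^sup>2 * (1 + L / real n) ^ c) * (1 + L / real n) + K / (real n)\<^sup>2 * (1 + L / real n) ^ Suc c"
    proof (rule add_mono)
      show "norm (zero_psi P (t c) - y) * (1 + L / real n) \<le> (K * real c / (real n)\<^sup>2 * (1 + L / real n) ^ c) * (1 + L / real n)"
        using Suc K by (intro mult_right_mono) (auto simp: P_def)
      have "1 \<le> (1 + L / real n) ^ Suc c" using K by (intro one_le_power) auto
      then have "K / (real n)\<^sup>2 * 1 \<le> K / (real n)\<^sup>2 * (1 + L / real n) ^ Suc c"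
        using K by (intro mult_left_mono) auto
      then show "K / (real n)\<^sup>2 \<le> K / (real n)\<^sup>2 * (1 + L / real n) ^ Suc c" by simp
    qed
    also have "\<dots> = K * real (Suc c) / (real n)\<^sup>2 * (1 + L / real n) ^ Suc c"
      by (simp add: algebra_simps add_divide_distrib)
    finally show ?case by (simp add: mult_laguerre_Suc P_def)
  qed
  from this[of C] show "norm (zero_psi (mult_laguerre n b C) (t C) - y) \<le> K * real C / (real n)\<^sup>2 * (1 + L / real n) ^ C" by simp
qed

text \<open>The end point at time \<open>\<gamma>\<close> of the characteristic with value \<open>y\<close>; as a function of \<open>y\<close> it is the local
  inverse of \<open>\<psi>\<close> for the limit measure.\<close>
definition inv_psi :: "complex \<Rightarrow> real \<Rightarrow> complex \<Rightarrow> complex" where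
  "inv_psi \<beta> \<gamma> y = y / (1 + y) * exp (of_real \<gamma> / (\<beta> + 1 + y))"

text \<open>The end points of the discrete characteristics converge to \<open>inv_psi\<close>, and the functions \<open>\<psi>\<close> are uniformly
  Lipschitz near \<open>0\<close>, so the Gronwall bound, which is of order \<open>1 / n\<close>, passes to the limit point.\<close>
lemma zero_psi_tendsto:
  fixes b :: "nat \<Rightarrow> complex" and c :: "nat \<Rightarrow> nat"
  assumes b: "(\<lambda>n. b n / of_nat n) \<longlonglongrightarrow> \<beta>" and c: "(\<lambda>n. real (c n) / real n) \<longlonglongrightarrow> \<gamma>"
    and \<beta>: "\<beta> + 1 \<noteq> 0" and R: "R > 0"
    and roots: "eventually (\<lambda>n. \<forall>k\<le>c n. \<forall>z. poly (mult_laguerre n (b n) k) z = 0 \<longrightarrow> norm z \<le> R) sequentially"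
  shows "\<exists>\<rho>>0. \<forall>y. norm y < \<rho> \<longrightarrow> R * norm (inv_psi \<beta> \<gamma> y) \<le> 1/2 \<and>
     (\<lambda>n. zero_psi (mult_laguerre n (b n) (c n)) (inv_psi \<beta> \<gamma> y)) \<longlonglongrightarrow> y"
proof -
  define q0 where "q0 = norm (\<beta> + 1) / 4"
  define \<Gamma> where "\<Gamma> = \<gamma> + 1"
  define r where "r = min (1 / (2 * R)) (q0 / (2 * R))"
  define \<rho> where "\<rho> = min (1/2) (min q0 (r / (2 * exp (2 * \<Gamma> / q0))))"
  define q where "q n = 1 + b n / of_nat n" for n
  have q0: "q0 > 0" using \<beta> by (simp add: q0_def)
  have r: "r > 0" "R * r \<le> 1/2" "2 * R * r \<le> q0"
    using q0 R by (auto simp: r_def min_def field_simps)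
  have \<rho>: "\<rho> > 0" using q0 r by (simp add: \<rho>_def)
  have q_lim: "q \<longlonglongrightarrow> \<beta> + 1" unfolding q_def by (rule tendsto_eq_intros b refl | simp)+
  have ev_n: "eventually (\<lambda>n. n > 0 \<and> 2 \<le> real n * q0) sequentially"
  proof -
    obtain N where "2 / q0 \<le> real N" using real_arch_simple by blast
    then have "2 \<le> real n * q0" if "n \<ge> N" for n
    proof -
      have "2 / q0 \<le> real n" using that \<open>2 / q0 \<le> real N\<close> by linarith
      then show ?thesis using q0 by (simp add: field_simps)
    qed
    then show ?thesis unfolding eventually_sequentially by (intro exI[of _ "max 1 N"]) auto
  qed
  have ev_q: "eventually (\<lambda>n. norm (q n) \<ge> 2 * q0) sequentially"
  proof -
    have "(\<lambda>n. norm (q n)) \<longlonglongrightarrow> norm (\<beta> + 1)" using q_lim by (rule tendsto_norm)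
    then have "eventually (\<lambda>n. norm (q n) > 2 * q0) sequentially"
      by (rule order_tendstoD(1)) (use \<beta> in \<open>simp add: q0_def\<close>)
    then show ?thesis by eventually_elim simp
  qed
  have ev_c: "eventually (\<lambda>n. real (c n) \<le> \<Gamma> * real n) sequentially"
    using order_tendstoD(2)[OF c, of \<Gamma>, unfolded \<Gamma>_def, simplified] ev_n
    unfolding \<Gamma>_def by eventually_elim (simp add: field_simps)
  show ?thesis
  proof (intro exI[of _ \<rho>] conjI allI impI \<rho>)
    fix y :: complex assume y: "norm y < \<rho>"
    have y2: "norm y \<le> 1/2" "norm y \<le> q0" using y by (auto simp: \<rho>_def)
    have "norm y \<le> r / (2 * exp (2 * \<Gamma> / q0))" using y by (auto simp: \<rho>_def)
    then have y3: "2 * norm y * exp (2 * \<Gamma> / q0) \<le> r" by (simp add: field_simps)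
    have nb: "norm (inv_psi \<beta> \<gamma> y) \<le> r \<and> (\<lambda>n. zero_psi (mult_laguerre n (b n) (c n)) (inv_psi \<beta> \<gamma> y)) \<longlonglongrightarrow> y"
    proof (cases "y = 0")
      case True
      have "zero_psi P 0 = 0" for P by (simp add: zero_psi_def zero_mean_def)
      then show ?thesis using True r by (simp add: inv_psi_def)
    next
      case False
      define a where "a n = 1 / (of_nat n * (q n + y))" for n
      define t where "t n = y / (1 + y) / (1 - a n) ^ c n" for n
      have By: "\<beta> + 1 + y \<noteq> 0"
      proof
        assume "\<beta> + 1 + y = 0"
        then have "norm (\<beta> + 1) = norm y" by (metis add_eq_0_iff2 norm_minus_cancel)
        then show False using y2 q0 by (simp add: q0_def)
      qed
      have inv0: "(\<lambda>n. 1 / (of_nat n :: complex)) \<longlonglongrightarrow> 0" by (rule lim_1_over_n)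
      have qy: "(\<lambda>n. q n + y) \<longlonglongrightarrow> \<beta> + 1 + y" by (intro tendsto_intros q_lim)
      have a0: "(\<lambda>n. - a n) \<longlonglongrightarrow> 0"
      proof -
        have "(\<lambda>n. - (1 / of_nat n / (q n + y))) \<longlonglongrightarrow> - (0 / (\<beta> + 1 + y))"
          by (intro tendsto_intros inv0 qy By)
        then show ?thesis by (simp add: a_def)
      qed
      have ca: "(\<lambda>n. of_nat (c n) * - a n) \<longlonglongrightarrow> - (of_real \<gamma> / (\<beta> + 1 + y))"
      proof -
        have "(\<lambda>n. - (of_real (real (c n) / real n) / (q n + y))) \<longlonglongrightarrow> - (of_real \<gamma> / (\<beta> + 1 + y))"
          by (intro tendsto_intros c qy By)
        then show ?thesis by (simp add: a_def)
      qed
      have "(\<lambda>n. (1 + - a n) ^ c n) \<longlonglongrightarrow> exp (- (of_real \<gamma> / (\<beta> + 1 + y)))"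
        by (rule tendsto_one_plus_power_exp[OF a0 ca])
      then have "t \<longlonglongrightarrow> y / (1 + y) / exp (- (of_real \<gamma> / (\<beta> + 1 + y)))"
        unfolding t_def by (intro tendsto_intros) auto
      then have t_lim: "t \<longlonglongrightarrow> inv_psi \<beta> \<gamma> y"
        by (simp add: inv_psi_def exp_minus divide_inverse)
      define L where "L = 2 / q0\<^sup>2"
      define K where "K = 2 / q0\<^sup>2 + 2 / q0\<^sup>2 * (2 / q0 + 2 / q0\<^sup>2)"
      have K: "K \<ge> 0" "L \<ge> 0" using q0 by (auto simp: K_def L_def)
      have est: "eventually (\<lambda>n. norm (zero_psi (mult_laguerre n (b n) (c n)) (t n) - y) \<le> K * real (c n) / (real n)\<^sup>2 * (1 + L / real n) ^ c n
         \<and> norm (t n) \<le> r \<and> degree (mult_laguerre n (b n) (c n)) > 0) sequentially"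
        using ev_n ev_q ev_c roots
      proof eventually_elim
        case (elim n)
        have "of_nat n + b n \<noteq> 0"
        proof
          assume "of_nat n + b n = 0"
          then have "b n = - of_nat n" by (simp add: add_eq_0_iff)
          then have "q n = 0" using elim by (simp add: q_def)
          then show False using elim q0 by simp
        qed
        then have "degree (mult_laguerre n (b n) (c n)) > 0" using elim by (simp add: degree_mult_laguerre)
        moreover have "norm (zero_psi (mult_laguerre n (b n) (c n)) (t n) - y) \<le> K * real (c n) / (real n)\<^sup>2 * (1 + L / real n) ^ c n"
          unfolding t_def a_def q_def K_def L_def
          by (rule characteristic_error(1)[where ?q0.0 = q0 and R = R and r = r and \<Gamma> = \<Gamma>])
             (use elim R r q0 y2 y3 False in \<open>auto simp: q_def\<close>)
        moreover have "norm (t n) \<le> r"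
          unfolding t_def a_def q_def 
          by (rule characteristic_error(2)[where ?q0.0 = q0 and R = R and r = r and \<Gamma> = \<Gamma>])
             (use elim R r q0 y2 y3 False in \<open>auto simp: q_def\<close>)
        ultimately show ?case by blast
      qed
      have nr: "norm (inv_psi \<beta> \<gamma> y) \<le> r"
        by (rule tendsto_upperbound[OF tendsto_norm[OF t_lim]]) (use est in \<open>auto elim: eventually_mono\<close>)
      have "(\<lambda>n. zero_psi (mult_laguerre n (b n) (c n)) (inv_psi \<beta> \<gamma> y) - y) \<longlonglongrightarrow> 0"
      proof (rule Lim_null_comparison)
        show "eventually (\<lambda>n. norm (zero_psi (mult_laguerre n (b n) (c n)) (inv_psi \<beta> \<gamma> y) - y) \<le>
           4 * R * norm (inv_psi \<beta> \<gamma> y - t n) + K * \<Gamma> * exp (L * \<Gamma>) * (1 / real n)) sequentially"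
          using est roots ev_c ev_n
        proof eventually_elim
          case (elim n)
          let ?P = "mult_laguerre n (b n) (c n)"
          have Rr: "R * norm (t n) \<le> 1/2" "R * norm (inv_psi \<beta> \<gamma> y) \<le> 1/2"
          proof -
            have "R * norm (t n) \<le> R * r" "R * norm (inv_psi \<beta> \<gamma> y) \<le> R * r"
              using elim nr R by (auto intro!: mult_left_mono)
            then show "R * norm (t n) \<le> 1/2" "R * norm (inv_psi \<beta> \<gamma> y) \<le> 1/2" using r by linarith+
          qed
          have "norm (zero_psi ?P (inv_psi \<beta> \<gamma> y) - y) \<le> norm (zero_psi ?P (inv_psi \<beta> \<gamma> y) - zero_psi ?P (t n)) + norm (zero_psi ?P (t n) - y)"
            using norm_triangle_ineq[of "zero_psi ?P (inv_psi \<beta> \<gamma> y) - zero_psi ?P (t n)" "zero_psi ?P (t n) - y"] by simp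
          also have "norm (zero_psi ?P (inv_psi \<beta> \<gamma> y) - zero_psi ?P (t n)) \<le> 4 * R * norm (inv_psi \<beta> \<gamma> y - t n)"
            using elim Rr by (intro zero_psi_lipschitz) auto
          also have "norm (zero_psi ?P (t n) - y) \<le> K * real (c n) / (real n)\<^sup>2 * (1 + L / real n) ^ c n" using elim by blast
          also have "\<dots> \<le> K * (\<Gamma> * real n) / (real n)\<^sup>2 * exp (L * \<Gamma>)"
          proof (intro mult_mono divide_right_mono mult_left_mono)
            have "(1 + L / real n) ^ c n \<le> exp (L / real n) ^ c n"
              using K by (intro power_mono exp_ge_add_one_self) auto
            also have "\<dots> = exp (real (c n) * (L / real n))" by (rule exp_of_nat_mult[symmetric])
            also have "\<dots> \<le> exp (L * \<Gamma>)"
            proof -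
              have "real (c n) * L \<le> \<Gamma> * real n * L" using elim K by (intro mult_right_mono) auto
              then show ?thesis using elim by (simp add: field_simps)
            qed
            finally show "(1 + L / real n) ^ c n \<le> exp (L * \<Gamma>)" .
          qed (use elim K in \<open>auto intro: order.trans[of 0 "real (c n)"]\<close>)
          also have "K * (\<Gamma> * real n) / (real n)\<^sup>2 * exp (L * \<Gamma>) = K * \<Gamma> * exp (L * \<Gamma>) * (1 / real n)"
            using elim by (simp add: power2_eq_square)
          finally show ?case by simp
        qed
        have "(\<lambda>n. 4 * R * norm (inv_psi \<beta> \<gamma> y - t n) + K * \<Gamma> * exp (L * \<Gamma>) * (1 / real n)) \<longlonglongrightarrow>
           4 * R * norm (inv_psi \<beta> \<gamma> y - inv_psi \<beta> \<gamma> y) + K * \<Gamma> * exp (L * \<Gamma>) * 0"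
          by (intro tendsto_intros t_lim lim_1_over_n)
        then show "(\<lambda>n. 4 * R * norm (inv_psi \<beta> \<gamma> y - t n) + K * \<Gamma> * exp (L * \<Gamma>) * (1 / real n)) \<longlonglongrightarrow> 0" by simp
      qed
      then show ?thesis using nr LIM_zero_iff by blast
    qed
    then have "R * norm (inv_psi \<beta> \<gamma> y) \<le> R * r" using R by (intro mult_left_mono) auto
    then show "R * norm (inv_psi \<beta> \<gamma> y) \<le> 1/2" using r by linarith
    show "(\<lambda>n. zero_psi (mult_laguerre n (b n) (c n)) (inv_psi \<beta> \<gamma> y)) \<longlonglongrightarrow> y" using nb by blast
  qed
qed

section \<open>Zeros of multiplicative Laguerre polynomials\<close>

lemma mult_laguerre_zeros_unitary:
  assumes n: "n > 0" and b: "Re b = - real n / 2" and z: "poly (mult_laguerre n b c) z = 0"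
  shows "norm z = 1"
  using z
proof (induction c arbitrary: z)
  case 0
  then show ?case using mult_laguerre_0_root[OF n] by simp
next
  case (Suc c)
  have "of_nat n + b \<noteq> 0"
  proof
    assume "of_nat n + b = 0"
    then have "Re (of_nat n + b) = 0" by simp
    then show False using b n by simp
  qed
  then have "degree (mult_laguerre n b c) = n" by (rule degree_mult_laguerre)
  then show ?case using Suc b n
    by (intro euler_op_zeros_unitary[of "mult_laguerre n b c" b z]) (auto simp: mult_laguerre_Suc)
qed

lemma degree_mult_laguerre_real:
  assumes "n > 0" "b \<notin> {- real n..0}"
  shows "degree (mult_laguerre n (of_real b) c) = n"
proof (rule degree_mult_laguerre)
  have "real n + b \<noteq> 0" using assms by auto
  then show "of_nat n + complex_of_real b \<noteq> 0"
    by (metis of_real_add of_real_eq_0_iff of_real_of_nat_eq)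
qed

lemma mult_laguerre_zeros_le_1:
  assumes n: "n > 0" and b: "b > 0" and z: "poly (mult_laguerre n (of_real b) c) z = 0"
  shows "z \<in> of_real ` {0<..1}"
  using z
proof (induction c arbitrary: z)
  case 0
  then show ?case using mult_laguerre_0_root[OF n] by auto
next
  case (Suc c)
  have "b \<notin> {- real n..0}" using b by simp
  note deg = degree_mult_laguerre_real[OF n this, of c]
  show ?case
    by (rule euler_op_zeros_le[of "mult_laguerre n (of_real b) c" b])
       (use deg n b Suc.IH Suc.prems in \<open>simp_all only: mult_laguerre_Suc\<close>)
qed

text \<open>Iterating the barrier, starting from \<open>t = y / (1 + y)\<close>, where \<open>\<psi>\<close> of \<open>(x - 1) ^ n\<close> equals \<open>y\<close>.\<close>
lemma mult_laguerre_zeros_bounded: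
  assumes n: "n > 0" and b: "b = - B * real n" and y: "0 < y" "2 * y \<le> B - 1"
    and z: "poly (mult_laguerre n (of_real b) c) z = 0"
  shows "z \<in> of_real ` {0<..(1 + y) / y * exp (real c / (real n * y))}"
proof -
  define s where "s = 1 + 1 / (real n * y)"
  have s1: "s \<ge> 1" using n y by (simp add: s_def)
  have bn: "b \<notin> {- real n..0}" using b y n by auto
  have deg: "degree (mult_laguerre n (of_real b) c) = n" for c
    by (rule degree_mult_laguerre_real[OF n bn])
  have "\<exists>t. t \<ge> y / (1 + y) / s ^ c \<and> t > 0 \<and>
    (\<forall>z. poly (mult_laguerre n (of_real b) c) z = 0 \<longrightarrow> z \<in> of_real ` {0<..<1/t}) \<and>
    Re (zero_psi (mult_laguerre n (of_real b) c) (of_real t)) \<le> y" for c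
  proof (induction c)
    case 0
    have "of_real (y / (1 + y)) / (1 - of_real (y / (1 + y))) = (of_real ((y / (1 + y)) / (1 - y / (1 + y))) :: complex)"
      by simp
    also have "(y / (1 + y)) / (1 - y / (1 + y)) = y" using y by (simp add: field_simps)
    finally show ?case using y n
      by (intro exI[of _ "y / (1 + y)"])
         (auto simp: zero_psi_mult_laguerre_0 mult_laguerre_0_root intro!: image_eqI[of _ _ 1])
  next
    case (Suc c)
    then obtain t where t: "t \<ge> y / (1 + y) / s ^ c" "t > 0"
      "\<And>z. poly (mult_laguerre n (of_real b) c) z = 0 \<Longrightarrow> z \<in> of_real ` {0<..<1/t}"
      "Re (zero_psi (mult_laguerre n (of_real b) c) (of_real t)) \<le> y" by blast
    define t' where "t' = t / (1 + 1 / (real n * (B - 1 - y)))"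
    note bar = euler_op_zeros_barrier[of "mult_laguerre n (of_real b) c" b B y t t', unfolded deg,
      OF n b y(1) _ t(3) t(2) t(4) t'_def, folded mult_laguerre_Suc]
    have yB: "y < B - 1" using y by simp
    note bar = bar[OF yB]
    have "y / (1 + y) / s ^ Suc c \<le> t / s"
      using t(1) s1 divide_right_mono[of "y / (1 + y) / s ^ c" t s] by (simp add: mult_ac)
    also have "\<dots> \<le> t'"
    proof -
      have "1 / (real n * (B - 1 - y)) \<le> 1 / (real n * y)"
        using n y yB by (intro divide_left_mono mult_left_mono mult_pos_pos) auto
      moreover have "1 / (real n * (B - 1 - y)) > 0" "1 / (real n * y) > 0" using n yB y by simp_all
      ultimately show ?thesis unfolding t'_def s_def using t(2)
        by (intro divide_left_mono mult_pos_pos add_pos_pos) linarith+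
    qed
    finally have t'1: "y / (1 + y) / s ^ Suc c \<le> t'" .
    have "z \<in> of_real ` {0<..<1/t'}" if "poly (mult_laguerre n (of_real b) (Suc c)) z = 0" for z
    proof -
      have "z \<in> of_real ` {0<..<1/t}" using bar(1) that by blast
      moreover have "1/t \<le> 1/t'" using bar(3,4) t(2) by (intro divide_left_mono mult_pos_pos) auto
      ultimately show ?thesis by force
    qed
    then show ?case using bar(2,3) t'1 by blast
  qed
  from this[of c] obtain t where t: "t \<ge> y / (1 + y) / s ^ c" "t > 0"
    "z \<in> of_real ` {0<..<1/t}" using z by blast
  have "s ^ c \<le> exp (1 / (real n * y)) ^ c"
    using s1 unfolding s_def by (intro power_mono exp_ge_add_one_self) auto
  also have "\<dots> = exp (real c * (1 / (real n * y)))" by (rule exp_of_nat_mult[symmetric])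
  finally have sc: "s ^ c \<le> exp (real c / (real n * y))" by simp
  have pos: "y / (1 + y) / s ^ c > 0" using y s1 by (simp add: zero_less_power)
  have "1 / t \<le> 1 / (y / (1 + y) / s ^ c)"
    using t pos by (intro divide_left_mono mult_pos_pos) auto
  also have "\<dots> = (1 + y) / y * s ^ c" by simp
  also have "\<dots> \<le> (1 + y) / y * exp (real c / (real n * y))"
    using sc y by (intro mult_left_mono) auto
  finally have le: "1 / t \<le> (1 + y) / y * exp (real c / (real n * y))" .
  from t(3) obtain x where x: "z = of_real x" "x \<in> {0<..<1/t}" by (rule imageE)
  then have "x < 1/t" by simp
  then have "x \<le> (1 + y) / y * exp (real c / (real n * y))" using le by linarith
  then show ?thesis unfolding x(1) using x(2) by (intro imageI) simp
qed

lemma positive_case_zeros_bounded: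
  assumes pos: "positive_case b \<beta>" and b: "(\<lambda>n. b n / of_nat n) \<longlonglongrightarrow> \<beta>"
    and c: "(\<lambda>n. real (c n) / real n) \<longlonglongrightarrow> \<gamma>" and "\<gamma> > 0"
  shows "\<exists>R>0. eventually (\<lambda>n. \<forall>k\<le>c n. \<forall>z. poly (mult_laguerre n (b n) k) z = 0 \<longrightarrow>
    z \<in> of_real ` {0<..R}) sequentially"
proof -
  obtain \<beta>' where \<beta>': "\<beta> = of_real \<beta>'" using pos by (auto simp: positive_case_def elim: Reals_cases)
  have br: "b n = of_real (Re (b n))" if "n > 0" for n
    using pos that by (auto simp: positive_case_def)
  have bl: "(\<lambda>n. Re (b n) / real n) \<longlonglongrightarrow> \<beta>'"
    using tendsto_Re[OF b] by (simp add: \<beta>' Re_divide_of_nat)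
  have ev: "eventually (\<lambda>n::nat. n > 0) sequentially" by (rule eventually_gt_at_top)
  have "\<beta>' \<notin> {-1..0}" using pos unfolding positive_case_def \<beta>' by blast
  then consider "\<beta>' > 0" | "\<beta>' < -1" unfolding atLeastAtMost_iff by linarith
  then show ?thesis
  proof cases
    case 1
    show ?thesis
    proof (intro exI[of _ 1] conjI)
      show "eventually (\<lambda>n. \<forall>k\<le>c n. \<forall>z. poly (mult_laguerre n (b n) k) z = 0 \<longrightarrow>
        z \<in> of_real ` {0<..1}) sequentially"
        using order_tendstoD(1)[OF bl 1] ev
      proof eventually_elim
        case (elim n)
        obtain r where r: "b n = of_real r" using br[OF elim(2)] by blast
        have "r > 0" using elim by (simp add: r zero_less_divide_iff)
        then show ?case using mult_laguerre_zeros_le_1[OF elim(2)] unfolding r by blast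
      qed
    qed simp
  next
    case 2
    \<comment> \<open>Any \<open>y > 0\<close> with \<open>2 * y < - \<beta>' - 1\<close> works: the condition \<open>2 * y \<le> B - 1\<close> then holds for large \<open>n\<close>.\<close>
    define y where "y = (- \<beta>' - 1) / 4"
    have y: "y > 0" using 2 by (simp add: y_def)
    define R where "R = (1 + y) / y * exp ((\<gamma> + 1) / y)"
    show ?thesis
    proof (intro exI[of _ R] conjI)
      show "R > 0" using y by (simp add: R_def)
      have "\<beta>' < - (1 + 2 * y)" using 2 by (simp add: y_def field_simps)
      note ev1 = order_tendstoD(2)[OF bl this]
      have "\<gamma> < \<gamma> + 1" by simp
      note ev2 = order_tendstoD(2)[OF c this]
      show "eventually (\<lambda>n. \<forall>k\<le>c n. \<forall>z. poly (mult_laguerre n (b n) k) z = 0 \<longrightarrow>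
        z \<in> of_real ` {0<..R}) sequentially"
        using ev1 ev2 ev
      proof eventually_elim
        case (elim n)
        obtain r where r: "b n = of_real r" using br[OF elim(3)] by blast
        define B where "B = - (r / real n)"
        have B: "r = - B * real n" "2 * y \<le> B - 1" using elim by (auto simp: B_def r)
        show ?case
        proof (intro allI impI)
          fix k z assume k: "k \<le> c n" and z: "poly (mult_laguerre n (b n) k) z = 0"
          have "poly (mult_laguerre n (of_real r) k) z = 0" using z by (simp add: r)
          from mult_laguerre_zeros_bounded[OF elim(3) B(1) y B(2) this]
          have zz: "z \<in> of_real ` {0<..(1 + y) / y * exp (real k / (real n * y))}" .
          have "real k / real n \<le> \<gamma> + 1"
          proof -
            have "real k / real n \<le> real (c n) / real n" using k by (intro divide_right_mono) auto
            then show ?thesis using elim by linarith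
          qed
          then have "real k / real n / y \<le> (\<gamma> + 1) / y" using y by (intro divide_right_mono) auto
          then have le: "(1 + y) / y * exp (real k / (real n * y)) \<le> R"
            unfolding R_def using y by (intro mult_left_mono) auto
          from zz obtain x where x: "z = of_real x" "x \<in> {0<..(1 + y) / y * exp (real k / (real n * y))}"
            by (rule imageE)
          have "x \<le> (1 + y) / y * exp (real k / (real n * y))" using x(2) by simp
          then have "x \<le> R" using le by linarith
          then show "z \<in> of_real ` {0<..R}" unfolding x(1) using x(2) by (intro imageI) simp
        qed
      qed
    qed
  qed
qed

section \<open>Zero distributions and weak compactness\<close>

text \<open>The zero distribution on the finite set of zeros with its discrete \<open>\<sigma>\<close>-algebra. Every function on it is
  measurable, so the zeros can be pulled back to a parameter interval by an arbitrary inverse of the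
  parametrisation.\<close>
definition zero_point_measure :: "complex poly \<Rightarrow> complex measure" where
  "zero_point_measure P = point_measure {z. poly P z = 0} (\<lambda>z. ennreal (real (order z P) / real (degree P)))"

lemma space_zero_point_measure: "space (zero_point_measure P) = {z. poly P z = 0}"
  by (simp add: zero_point_measure_def space_point_measure)

lemma measurable_zero_point_measure: "h \<in> measurable (zero_point_measure P) borel"
  by (simp add: zero_point_measure_def)

lemma zero_dist_eq_distr:
  assumes P: "P \<noteq> 0" and h: "\<And>z. poly P z = 0 \<Longrightarrow> h z = z"
  shows "zero_dist (degree P) P = distr (zero_point_measure P) borel h"
proof (rule measure_eqI)
  fix A assume "A \<in> sets (zero_dist (degree P) P)"
  then have A: "A \<in> sets borel" by simp
  let ?Z = "{z. poly P z = 0}" and ?w = "\<lambda>z. ennreal (real (order z P) / real (degree P))"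
  have fin: "finite ?Z" using P by (rule poly_roots_finite)
  have "h -` A \<inter> ?Z = ?Z \<inter> A" using h by auto
  then have "emeasure (distr (zero_point_measure P) borel h) A = emeasure (zero_point_measure P) (?Z \<inter> A)"
    using A by (simp add: emeasure_distr measurable_zero_point_measure space_zero_point_measure)
  also have "\<dots> = (\<Sum>z\<in>?Z \<inter> A. ?w z)"
    unfolding zero_point_measure_def by (rule emeasure_point_measure_finite) (use fin in auto)
  also have "\<dots> = (\<Sum>z\<in>?Z. ?w z * emeasure (return borel z) A)"
    using A fin by (simp add: sum.inter_restrict indicator_def if_distrib cong: if_cong)
  finally show "emeasure (zero_dist (degree P) P) A = emeasure (distr (zero_point_measure P) borel h) A"
    using A by (simp add: emeasure_zero_dist)
qed simp

lemma prob_space_zero_point_measure: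
  assumes "degree P > 0"
  shows "prob_space (zero_point_measure P)"
proof
  have P: "P \<noteq> 0" using assms by auto
  then have "emeasure (zero_point_measure P) {z. poly P z = 0} =
      (\<Sum>z | poly P z = 0. ennreal (real (order z P) / real (degree P)))"
    unfolding zero_point_measure_def using poly_roots_finite[OF P] by (intro emeasure_point_measure_finite) auto
  also have "\<dots> = ennreal (\<Sum>z | poly P z = 0. real (order z P) / real (degree P))"
    by (intro sum_ennreal) auto
  also have "(\<Sum>z | poly P z = 0. real (order z P) / real (degree P)) = 1"
    using sum_order_complex[OF P] assms by (simp flip: sum_divide_distrib of_nat_sum)
  finally show "emeasure (zero_point_measure P) (space (zero_point_measure P)) = 1" by (simp add: space_zero_point_measure)
qed

lemma integral_zero_dist:
  assumes P: "degree P > 0" and f: "f \<in> borel_measurable borel"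
  shows "(\<integral>z. f z \<partial>zero_dist (degree P) P) = zero_mean P f"
proof -
  have P0: "P \<noteq> 0" using P by auto
  have "(\<integral>z. f z \<partial>zero_dist (degree P) P) = (\<integral>z. f z \<partial>zero_point_measure P)"
    using P0 f by (subst zero_dist_eq_distr[where h = "\<lambda>z. z"])
      (auto simp: integral_distr measurable_zero_point_measure)
  also have "\<dots> = (\<Sum>z | poly P z = 0. (real (order z P) / real (degree P)) *\<^sub>R f z)"
    unfolding zero_point_measure_def using poly_roots_finite[OF P0]
    by (intro lebesgue_integral_point_measure_finite) auto
  also have "\<dots> = zero_mean P f"
    by (simp add: zero_mean_def sum_divide_distrib scaleR_conv_of_real)
  finally show ?thesis .
qed

text \<open>Helly's theorem on the parameter interval, pushed forward to the curve. The limit on the line stays in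
  \<open>{a..b}\<close> because the truncated distance to this interval has integral zero throughout.\<close>
lemma helly_on_curve:
  fixes L :: "nat \<Rightarrow> real measure" and g :: "real \<Rightarrow> complex"
  assumes L: "\<And>n. real_distribution (L n)" and supp: "\<And>n. AE x in L n. x \<in> {a..b}"
    and g: "continuous_on UNIV g"
  shows "\<exists>r N. strict_mono r \<and> prob_measure_on (g ` {a..b}) N \<and>
    weakly_converges (\<lambda>k. distr (L (r k)) borel g) N"
proof -
  have ab: "a \<le> b"
  proof (rule ccontr)
    assume "\<not> a \<le> b"
    then have "AE x in L 0. False" using supp[of 0] by simp
    moreover interpret real_distribution "L 0" by (rule L)
    have "\<not> (AE x in L 0. False)" by simp
    ultimately show False by contradiction
  qed
  have "tight L"
    unfolding tight_def
  proof (intro conjI allI impI L)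
    fix \<epsilon> :: real assume \<epsilon>: "\<epsilon> > 0"
    have "measure (L n) {a - 1<..b} > 1 - \<epsilon>" for n
    proof -
      interpret real_distribution "L n" by (rule L)
      have "AE x in L n. x \<in> {a - 1<..b}" using supp[of n] by eventually_elim auto
      then have "measure (L n) {a - 1<..b} = 1" by (intro prob_eq_1[THEN iffD2]) auto
      then show ?thesis using \<epsilon> by simp
    qed
    then show "\<exists>a' b'. a' < b' \<and> (\<forall>n. measure (L n) {a'<..b'} > 1 - \<epsilon>)"
      using ab by (intro exI[of _ "a - 1"] exI[of _ b]) auto
  qed
  from tight_imp_convergent_subsubsequence[OF this, of "\<lambda>n. n"]
  obtain r M where r: "strict_mono r" and M: "real_distribution M"
    and conv: "weak_conv_m (L \<circ> (\<lambda>n. n) \<circ> r) M" by (auto simp: strict_mono_def)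
  have int: "(\<lambda>k. integral\<^sup>L (L (r k)) f) \<longlonglongrightarrow> integral\<^sup>L M f"
    if f: "continuous_on UNIV f" "\<And>x. norm (f x) \<le> B" for f :: "real \<Rightarrow> real" and B
    using weak_conv_imp_integral_bdd_continuous_conv[OF _ M conv, of f B] L f
    by (auto simp: o_def continuous_on_eq_continuous_at)
  interpret M: real_distribution M by (rule M)
  have g_meas: "g \<in> borel_measurable borel" by (rule borel_measurable_continuous_onI[OF g])
  have suppM: "AE x in M. x \<in> {a..b}"
  proof -
    define d where "d x = min 1 (infdist x {a..b})" for x :: real
    have nn: "0 \<le> infdist x {a..b}" for x :: real by (rule infdist_nonneg)
    have d: "continuous_on UNIV d" "\<And>x. norm (d x) \<le> 1" "\<And>x. d x \<ge> 0"
      subgoal unfolding d_def by (intro continuous_intros)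
      subgoal for x using nn[of x] by (simp add: d_def)
      subgoal for x using nn[of x] by (simp add: d_def)
      done
    have d0: "d x = 0" if "x \<in> {a..b}" for x using infdist_zero[OF that] by (simp add: d_def)
    have "integral\<^sup>L (L (r k)) d = 0" for k
    proof (rule integral_eq_zero_AE)
      show "AE x in L (r k). d x = 0" using supp[of "r k"] by eventually_elim (rule d0)
    qed
    then have "(\<lambda>k::nat. 0) \<longlonglongrightarrow> integral\<^sup>L M d" using int[OF d(1,2)] by simp
    then have "integral\<^sup>L M d = 0" by (simp add: LIMSEQ_const_iff)
    moreover have "integrable M d"
    proof (rule M.integrable_const_bound[where B = 1])
      have "d \<in> borel_measurable borel" by (rule borel_measurable_continuous_onI[OF d(1)])
      then show "d \<in> borel_measurable M" by simp
    qed (use d(2) in auto)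
    ultimately have "AE x in M. d x = 0"
      using d by (subst (asm) integral_nonneg_eq_0_iff_AE) auto
    then show ?thesis
    proof eventually_elim
      case (elim x)
      then have "infdist x {a..b} = 0" by (auto simp: d_def min_def split: if_splits)
      then show ?case using in_closed_iff_infdist_zero[of "{a..b}" x] ab by auto
    qed
  qed
  define N where "N = distr M borel g"
  have gM: "g \<in> measurable M borel" using g_meas by simp
  have "closed (g ` {a..b})"
    by (intro compact_imp_closed compact_continuous_image continuous_on_subset[OF g]) auto
  moreover have "AE x in M. g x \<in> g ` {a..b}" using suppM by eventually_elim (rule imageI)
  ultimately have "AE z in N. z \<in> g ` {a..b}"
    unfolding N_def using gM by (subst AE_distr_iff) auto
  then have "prob_measure_on (g ` {a..b}) N"
    unfolding prob_measure_on_def using M.prob_space_distr[OF gM] by (simp add: N_def)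
  moreover have "weakly_converges (\<lambda>k. distr (L (r k)) borel g) N"
    unfolding weakly_converges_def
  proof (intro allI impI)
    fix f :: "complex \<Rightarrow> real" assume f: "continuous_on UNIV f \<and> bounded (range f)"
    then obtain B where B: "\<And>x. norm (f x) \<le> B" by (auto simp: bounded_iff)
    have fm: "f \<in> borel_measurable borel" using f borel_measurable_continuous_onI by blast
    have "(\<lambda>k. integral\<^sup>L (L (r k)) (\<lambda>x. f (g x))) \<longlonglongrightarrow> integral\<^sup>L M (\<lambda>x. f (g x))"
      using f B by (intro int[where B = B] continuous_on_compose2[OF _ g, of _ f]) auto
    moreover have "integral\<^sup>L (distr K borel g) f = integral\<^sup>L K (\<lambda>x. f (g x))" if "real_distribution K" for K
    proof -
      interpret real_distribution K by fact
      show ?thesis using g_meas fm by (intro integral_distr) auto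
    qed
    ultimately show "(\<lambda>k. \<integral>x. f x \<partial>distr (L (r k)) borel g) \<longlonglongrightarrow> (\<integral>x. f x \<partial>N)"
      using L M by (simp add: N_def)
  qed
  ultimately show ?thesis using r by blast
qed

lemma weakly_converges_subseqI:
  assumes "\<And>s. strict_mono (s :: nat \<Rightarrow> nat) \<Longrightarrow> \<exists>r. strict_mono (r :: nat \<Rightarrow> nat) \<and> weakly_converges (\<lambda>k. M (s (r k))) N"
  shows "weakly_converges M N"
  unfolding weakly_converges_def
proof (intro allI impI, rule ccontr)
  fix f :: "'a \<Rightarrow> real" assume f: "continuous_on UNIV f \<and> bounded (range f)"
  assume "\<not> (\<lambda>n. \<integral>x. f x \<partial>M n) \<longlonglongrightarrow> (\<integral>x. f x \<partial>N)"
  then obtain e where e: "e > 0" "\<And>n0. \<exists>n\<ge>n0. \<not> dist (\<integral>x. f x \<partial>M n) (\<integral>x. f x \<partial>N) < e"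
    unfolding lim_sequentially by blast
  then have "infinite {n. \<not> dist (\<integral>x. f x \<partial>M n) (\<integral>x. f x \<partial>N) < e}"
    unfolding infinite_nat_iff_unbounded_le by blast
  from infinite_enumerate[OF this] obtain s :: "nat \<Rightarrow> nat" where s: "strict_mono s"
    "\<And>n. \<not> dist (\<integral>x. f x \<partial>M (s n)) (\<integral>x. f x \<partial>N) < e" by blast
  from assms[OF s(1)] obtain r :: "nat \<Rightarrow> nat" where "weakly_converges (\<lambda>k. M (s (r k))) N" by blast
  then have "(\<lambda>k. \<integral>x. f x \<partial>M (s (r k))) \<longlonglongrightarrow> (\<integral>x. f x \<partial>N)" using f by (simp add: weakly_converges_def)
  then have "eventually (\<lambda>k. dist (\<integral>x. f x \<partial>M (s (r k))) (\<integral>x. f x \<partial>N) < e) sequentially"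
    using e(1) by (rule tendstoD)
  then show False using s(2) by (auto simp: eventually_sequentially)
qed

section \<open>Measures are determined by their transform near zero\<close>

lemma integrable_bounded_on:
  fixes h :: "complex \<Rightarrow> 'b::{banach, second_countable_topology}"
  assumes N: "prob_measure_on K N" and h: "h \<in> borel_measurable borel"
    and B: "\<And>z. z \<in> K \<Longrightarrow> norm (h z) \<le> B"
  shows "integrable N h"
proof -
  interpret prob_space N using N by (simp add: prob_measure_on_def)
  have [measurable_cong]: "sets N = sets borel" using N by (simp add: prob_measure_on_def)
  have "AE z in N. z \<in> K" using N by (simp add: prob_measure_on_def)
  then have "AE z in N. norm (h z) \<le> B" by eventually_elim (rule B)
  then show ?thesis using h by (intro integrable_const_bound) auto
qed

lemma norm_integral_le_on:
  fixes h :: "complex \<Rightarrow> 'b::{banach, second_countable_topology}"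
  assumes N: "prob_measure_on K N" and h: "h \<in> borel_measurable borel"
    and B: "\<And>z. z \<in> K \<Longrightarrow> norm (h z) \<le> B" "B \<ge> 0"
  shows "norm (\<integral>z. h z \<partial>N) \<le> B"
proof -
  interpret prob_space N using N by (simp add: prob_measure_on_def)
  have "AE z in N. z \<in> K" using N by (simp add: prob_measure_on_def)
  then have ae: "AE z in N. norm (h z) \<le> B" by eventually_elim (rule B)
  have int: "integrable N h" by (rule integrable_bounded_on[OF N h B(1)])
  have "norm (\<integral>z. h z \<partial>N) \<le> (\<integral>z. norm (h z) \<partial>N)" by (rule integral_norm_bound)
  also have "\<dots> \<le> (\<integral>z. B \<partial>N)" using ae int by (intro integral_mono_AE) auto
  finally show ?thesis by (simp add: prob_space)
qed

text \<open>Termwise integration of the geometric series.\<close>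
lemma psi_sums:
  assumes N: "prob_measure_on K N" and K: "K \<subseteq> cball 0 R" and t: "R * norm t \<le> 1/2"
  shows "(\<lambda>k. moment N (Suc k) * t ^ Suc k) sums (\<integral>z. z * t / (1 - z * t) \<partial>N)"
proof -
  have meas: "(\<lambda>z::complex. (z * t) ^ Suc k) \<in> borel_measurable borel" for k by measurable
  have ztK: "norm (z * t) \<le> 1/2" if "z \<in> K" for z
  proof -
    have "norm z * norm t \<le> R * norm t" using K that by (intro mult_right_mono) auto
    then show ?thesis using t by (simp add: norm_mult)
  qed
  have pw: "norm ((z * t) ^ Suc k) \<le> (1/2) ^ Suc k" if "z \<in> K" for z k
    using ztK[OF that] unfolding norm_power by (intro power_mono) auto
  have int: "integrable N (\<lambda>z. (z * t) ^ Suc k)" for k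
    by (rule integrable_bounded_on[OF N meas pw])
  have AEK: "AE z in N. z \<in> K" using N by (simp add: prob_measure_on_def)
  have "(\<lambda>k. \<integral>z. (z * t) ^ Suc k \<partial>N) sums (\<integral>z. (\<Sum>k. (z * t) ^ Suc k) \<partial>N)"
  proof (rule sums_integral)
    show "integrable N (\<lambda>z. (z * t) ^ Suc k)" for k by (rule int)
    show "AE z in N. summable (\<lambda>k. norm ((z * t) ^ Suc k))"
      using AEK
    proof eventually_elim
      case (elim z)
      have "summable (\<lambda>k. (1/2 :: real) ^ Suc k)" by (subst summable_Suc_iff) (simp add: summable_geometric)
      then show ?case by (rule summable_comparison_test') (use pw[OF elim] in auto)
    qed
    show "summable (\<lambda>k. \<integral>z. norm ((z * t) ^ Suc k) \<partial>N)"
    proof (rule summable_comparison_test')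
      show "summable (\<lambda>k. (1/2 :: real) ^ Suc k)" by (subst summable_Suc_iff) (simp add: summable_geometric)
      show "norm (\<integral>z. norm ((z * t) ^ Suc k) \<partial>N) \<le> (1/2) ^ Suc k" if "k \<ge> 0" for k
        by (rule norm_integral_le_on[OF N]) (use pw meas in auto)
    qed
  qed
  also have "(\<integral>z. (\<Sum>k. (z * t) ^ Suc k) \<partial>N) = (\<integral>z. z * t / (1 - z * t) \<partial>N)"
  proof (rule integral_cong_AE)
    show "AE z in N. (\<Sum>k. (z * t) ^ Suc k) = z * t / (1 - z * t)"
      using AEK
    proof eventually_elim
      case (elim z)
      have "norm (z * t) < 1" using ztK[OF elim] by simp
      from sums_mult[OF geometric_sums[OF this], of "z * t"]
      show ?case by (simp add: sums_iff)
    qed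
    have sN: "sets N = sets borel" using N by (simp add: prob_measure_on_def)
    show "(\<lambda>z. \<Sum>k. (z * t) ^ Suc k) \<in> borel_measurable N"
      using int by (intro borel_measurable_suminf) auto
    show "(\<lambda>z. z * t / (1 - z * t)) \<in> borel_measurable N"
      unfolding measurable_cong_sets[OF sN refl] by measurable
  qed
  also have "(\<lambda>k. \<integral>z. (z * t) ^ Suc k \<partial>N) = (\<lambda>k. moment N (Suc k) * t ^ Suc k)"
    unfolding moment_def power_mult_distrib by (subst integral_mult_left_zero) (rule refl)
  finally show ?thesis .
qed

lemma psi_eq_integral:
  assumes "prob_measure_on K N" "K \<subseteq> cball 0 R" "R * norm t \<le> 1/2"
  shows "psi N t = (\<integral>z. z * t / (1 - z * t) \<partial>N)"
  using psi_sums[OF assms] by (simp add: psi_def sums_iff)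

text \<open>On such a set every mixed moment is a moment or the conjugate of one.\<close>
definition monomials_reduce :: "complex set \<Rightarrow> bool" where
  "monomials_reduce X \<longleftrightarrow> (\<forall>i j. \<exists>k. (\<forall>z\<in>X. z ^ i * cnj z ^ j = z ^ k) \<or> (\<forall>z\<in>X. z ^ i * cnj z ^ j = cnj (z ^ k)))"

lemma monomials_reduce_sphere: "monomials_reduce (sphere 0 1)"
  unfolding monomials_reduce_def
proof (intro allI)
  fix i j :: nat
  have zc: "z * cnj z = 1" if "norm z = 1" for z :: complex
    using that by (simp add: complex_norm_square[symmetric])
  show "\<exists>k. (\<forall>z\<in>sphere 0 1. z ^ i * cnj z ^ j = z ^ k) \<or> (\<forall>z\<in>sphere 0 1. z ^ i * cnj z ^ j = cnj (z ^ k))"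
  proof (cases "i \<le> j")
    case True
    have "z ^ i * cnj z ^ j = cnj (z ^ (j - i))" if "z \<in> sphere 0 1" for z :: complex
    proof -
      have "z ^ i * cnj z ^ j = (z * cnj z) ^ i * cnj z ^ (j - i)"
        using True by (simp add: power_mult_distrib mult.assoc flip: power_add)
      then show ?thesis using zc that by simp
    qed
    then show ?thesis by blast
  next
    case False
    have "z ^ i * cnj z ^ j = z ^ (i - j)" if "z \<in> sphere 0 1" for z :: complex
    proof -
      have "z ^ i * cnj z ^ j = (z * cnj z) ^ j * z ^ (i - j)"
        using False by (simp add: power_mult_distrib mult_ac flip: power_add)
      then show ?thesis using zc that by simp
    qed
    then show ?thesis by blast
  qed
qed

lemma monomials_reduce_real: "monomials_reduce (of_real ` A)"
  unfolding monomials_reduce_def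
proof (intro allI)
  fix i j :: nat
  have "z ^ i * cnj z ^ j = z ^ (i + j)" if "z \<in> of_real ` A" for z :: complex
    using that by (auto simp: power_add)
  then show "\<exists>k. (\<forall>z\<in>of_real ` A. z ^ i * cnj z ^ j = z ^ k) \<or> (\<forall>z\<in>of_real ` A. z ^ i * cnj z ^ j = cnj (z ^ k))"
    by blast
qed

lemma monomials_reduce_subset: "monomials_reduce X \<Longrightarrow> Y \<subseteq> X \<Longrightarrow> monomials_reduce Y"
  unfolding monomials_reduce_def by (meson subsetD)

text \<open>Polynomials in \<open>z\<close> and its conjugate are encoded as bivariate polynomials: the outer variable is evaluated
  at the constant polynomial \<open>[:cnj z:]\<close>, the inner one at \<open>z\<close>. Evaluation is then a ring homomorphism, which
  settles sums and products; real linear functionals are combinations of \<open>z\<close> and \<open>cnj z\<close>.\<close>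
lemma real_polynomial_function_complex:
  fixes f :: "complex \<Rightarrow> real"
  assumes "real_polynomial_function f"
  shows "\<exists>P :: complex poly poly. \<forall>z. of_real (f z) = poly (poly P [:cnj z:]) z"
  using assms
proof induction
  case (linear f)
  interpret bounded_linear f by fact
  define u v :: complex where "u = of_real (f 1)" and "v = of_real (f \<i>)"
  have "of_real (f z) = (u - \<i> * v) / 2 * z + (u + \<i> * v) / 2 * cnj z" for z
  proof -
    have "Re z *\<^sub>R 1 + Im z *\<^sub>R \<i> = z" by (simp add: complex_eq_iff)
    then have "f z = f (Re z *\<^sub>R 1 + Im z *\<^sub>R \<i>)" by (simp only:)
    also have "\<dots> = Re z * f 1 + Im z * f \<i>" by (simp only: add scaleR) simp
    finally show ?thesis by (simp add: u_def v_def complex_eq_iff field_simps)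
  qed
  then show ?case
    by (intro exI[of _ "[: [:0, (u - \<i> * v) / 2:], [:(u + \<i> * v) / 2:] :]"]) (auto simp: algebra_simps)
next
  case (const c)
  show ?case by (intro exI[of _ "[:[:of_real c:]:]"]) auto
next
  case (add f g)
  then obtain P Q :: "complex poly poly" where
    "\<And>z. of_real (f z) = poly (poly P [:cnj z:]) z" "\<And>z. of_real (g z) = poly (poly Q [:cnj z:]) z" by blast
  then show ?case by (intro exI[of _ "P + Q"]) simp
next
  case (mult f g)
  then obtain P Q :: "complex poly poly" where
    "\<And>z. of_real (f z) = poly (poly P [:cnj z:]) z" "\<And>z. of_real (g z) = poly (poly Q [:cnj z:]) z" by blast
  then show ?case by (intro exI[of _ "P * Q"]) simp
qed

lemma poly_poly_cnj:
  fixes z w :: complex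
  shows "poly (poly P [:w:]) z = (\<Sum>i\<le>degree P. \<Sum>j\<le>degree (coeff P i). coeff (coeff P i) j * (z ^ j * w ^ i))"
proof -
  have "poly (poly P [:w:]) z = poly (\<Sum>i\<le>degree P. coeff P i * [:w:] ^ i) z"
    by (subst poly_altdef) (rule refl)
  also have "\<dots> = (\<Sum>i\<le>degree P. poly (coeff P i) z * w ^ i)"
    by (simp add: poly_sum)
  also have "\<dots> = (\<Sum>i\<le>degree P. (\<Sum>j\<le>degree (coeff P i). coeff (coeff P i) j * z ^ j) * w ^ i)"
    by (simp only: poly_altdef)
  finally show ?thesis by (simp only: sum_distrib_right mult.assoc)
qed

text \<open>Polynomials in \<open>z\<close> and its conjugate are integrated by means of the moments and are uniformly dense on \<open>K\<close>.\<close>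
lemma integral_eq_of_moments_eq:
  fixes f :: "complex \<Rightarrow> real"
  assumes K: "compact K" "monomials_reduce K"
    and N: "prob_measure_on K N1" "prob_measure_on K N2"
    and mom: "\<And>k. moment N1 k = moment N2 k" and f: "continuous_on UNIV f"
  shows "(\<integral>z. f z \<partial>N1) = (\<integral>z. f z \<partial>N2)"
proof -
  have fm: "f \<in> borel_measurable borel" by (rule borel_measurable_continuous_onI[OF f])
  have bnd: "\<exists>B. \<forall>z\<in>K. norm (h z) \<le> B" if hc: "continuous_on UNIV h" for h :: "complex \<Rightarrow> 'b::real_normed_vector"
  proof -
    have "compact (h ` K)" by (intro compact_continuous_image continuous_on_subset[OF hc] K) auto
    then show ?thesis using compact_imp_bounded bounded_iff by (metis imageI)
  qed
  have int: "integrable N1 h" "integrable N2 h" if hc: "continuous_on UNIV h" for h :: "complex \<Rightarrow> 'b::{banach,second_countable_topology}"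
  proof -
    obtain B where "\<forall>z\<in>K. norm (h z) \<le> B" using bnd[OF hc] by blast
    then show "integrable N1 h" "integrable N2 h"
      using integrable_bounded_on[OF N(1) borel_measurable_continuous_onI[OF hc]]
        integrable_bounded_on[OF N(2) borel_measurable_continuous_onI[OF hc]] by blast+
  qed
  have cong: "integral\<^sup>L N h = integral\<^sup>L N h'" if "prob_measure_on K N" "\<And>z. z \<in> K \<Longrightarrow> h z = h' z"
      "continuous_on UNIV h" "continuous_on UNIV h'" for N and h h' :: "complex \<Rightarrow> complex"
  proof (rule integral_cong_AE)
    have sN: "sets N = sets borel" using that(1) by (simp add: prob_measure_on_def)
    show "h \<in> borel_measurable N" "h' \<in> borel_measurable N"
      unfolding measurable_cong_sets[OF sN refl] using that borel_measurable_continuous_onI by blast+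
    have "AE z in N. z \<in> K" using that(1) by (simp add: prob_measure_on_def)
    then show "AE z in N. h z = h' z" by eventually_elim (rule that)
  qed
  have mono: "(\<integral>z. z ^ i * cnj z ^ j \<partial>N1) = (\<integral>z. z ^ i * cnj z ^ j \<partial>N2)" for i j
  proof -
    obtain k where "(\<forall>z\<in>K. z ^ i * cnj z ^ j = z ^ k) \<or> (\<forall>z\<in>K. z ^ i * cnj z ^ j = cnj (z ^ k))"
      using K(2) unfolding monomials_reduce_def by blast
    then show ?thesis
    proof
      assume eq: "\<forall>z\<in>K. z ^ i * cnj z ^ j = z ^ k"
      have "(\<integral>z. z ^ i * cnj z ^ j \<partial>N) = moment N k" if "prob_measure_on K N" for N
        unfolding moment_def using eq by (intro cong[OF that]) (auto intro!: continuous_intros)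
      then show ?thesis using N mom by simp
    next
      assume eq: "\<forall>z\<in>K. z ^ i * cnj z ^ j = cnj (z ^ k)"
      have "(\<integral>z. z ^ i * cnj z ^ j \<partial>N) = cnj (moment N k)" if "prob_measure_on K N" for N
        unfolding moment_def Bochner_Integration.integral_cnj[symmetric] using eq by (intro cong[OF that]) (auto intro!: continuous_intros)
      then show ?thesis using N mom by simp
    qed
  qed
  have poly_eq: "(\<integral>z. g z \<partial>N1) = (\<integral>z. g z \<partial>N2)" if "real_polynomial_function g" for g :: "complex \<Rightarrow> real"
  proof -
    obtain P :: "complex poly poly" where P: "\<And>z. of_real (g z) = poly (poly P [:cnj z:]) z"
      using real_polynomial_function_complex[OF \<open>real_polynomial_function g\<close>] by blast
    have i: "integrable N1 (\<lambda>z. z ^ j * cnj z ^ i)" "integrable N2 (\<lambda>z. z ^ j * cnj z ^ i)" for i j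
      by (intro int continuous_intros)+
    have "complex_of_real (\<integral>z. g z \<partial>N1) = (\<integral>z. of_real (g z) \<partial>N1)" by simp
    also have "\<dots> = (\<Sum>i\<le>degree P. \<Sum>j\<le>degree (coeff P i). coeff (coeff P i) j * (\<integral>z. z ^ j * cnj z ^ i \<partial>N1))"
      unfolding P poly_poly_cnj using i by simp
    also have "\<dots> = (\<Sum>i\<le>degree P. \<Sum>j\<le>degree (coeff P i). coeff (coeff P i) j * (\<integral>z. z ^ j * cnj z ^ i \<partial>N2))"
      by (simp add: mono)
    also have "\<dots> = (\<integral>z. of_real (g z) \<partial>N2)"
      unfolding P poly_poly_cnj using i by simp
    also have "\<dots> = complex_of_real (\<integral>z. g z \<partial>N2)" by simp
    finally show ?thesis by (simp only: of_real_eq_iff)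
  qed
  show ?thesis
  proof (rule ccontr)
    define e where "e = \<bar>(\<integral>z. f z \<partial>N1) - (\<integral>z. f z \<partial>N2)\<bar> / 3"
    assume "(\<integral>z. f z \<partial>N1) \<noteq> (\<integral>z. f z \<partial>N2)"
    then have e: "e > 0" by (simp add: e_def)
    obtain g where g: "real_polynomial_function g" "\<And>z. z \<in> K \<Longrightarrow> \<bar>f z - g z\<bar> < e"
      using Stone_Weierstrass_real_polynomial_function[OF K(1) continuous_on_subset[OF f] e] by auto
    have gc: "continuous_on UNIV g"
      using g(1) continuous_on_polymonial_function real_polynomial_function_eq by blast
    have "\<bar>(\<integral>z. f z \<partial>N) - (\<integral>z. g z \<partial>N)\<bar> \<le> e" if N': "prob_measure_on K N" "N = N1 \<or> N = N2" for N
    proof -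
      have "(\<integral>z. f z \<partial>N) - (\<integral>z. g z \<partial>N) = (\<integral>z. f z - g z \<partial>N)"
        using N'(2) int[OF f] int[OF gc] by auto
      also have "norm \<dots> \<le> e"
        by (rule norm_integral_le_on[OF N'(1)])
           (use g(2) e less_imp_le in \<open>auto intro!: borel_measurable_continuous_onI continuous_intros f gc\<close>)
      finally show ?thesis by simp
    qed
    from this[OF N(1) disjI1[OF refl]] this[OF N(2) disjI2[OF refl]] poly_eq[OF g(1)] have "\<bar>(\<integral>z. f z \<partial>N1) - (\<integral>z. f z \<partial>N2)\<bar> \<le> 2 * e"
      by linarith
    then show False using e by (simp add: e_def)
  qed
qed

text \<open>The moments are the coefficients of the power series \<open>psi\<close>, and a power series that vanishes near \<open>0\<close> has
  only zero coefficients.\<close>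
lemma moments_eq_of_psi_eq:
  assumes N: "prob_measure_on K N1" "prob_measure_on K N2" and K: "K \<subseteq> cball 0 R" and R: "R > 0"
    and \<delta>: "\<delta> > 0" "\<And>t. norm t < \<delta> \<Longrightarrow> psi N1 t = psi N2 t"
  shows "moment N1 k = moment N2 k"
proof (cases k)
  case 0
  interpret N1: prob_space N1 using N by (simp add: prob_measure_on_def)
  interpret N2: prob_space N2 using N by (simp add: prob_measure_on_def)
  show ?thesis by (simp add: 0 moment_def N1.prob_space N2.prob_space)
next
  case (Suc m)
  define a where "a k = (if k = 0 then 0 else moment N1 k - moment N2 k)" for k
  define r where "r = min \<delta> (1 / (2 * R))"
  have r: "r > 0" using \<delta> R by (simp add: r_def)
  have sums0: "(\<lambda>k. a k * (x - 0) ^ k) sums 0" if "norm (x - 0) < r" for x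
  proof -
    have Rx: "R * norm x \<le> 1/2" using that R by (simp add: r_def field_simps)
    have "(\<lambda>k. moment N1 (Suc k) * x ^ Suc k - moment N2 (Suc k) * x ^ Suc k) sums (psi N1 x - psi N2 x)"
      using psi_sums[OF N(1) K Rx] psi_sums[OF N(2) K Rx] psi_eq_integral[OF N(1) K Rx] psi_eq_integral[OF N(2) K Rx]
      by (intro sums_diff) auto
    also have "psi N1 x - psi N2 x = 0" using \<delta>(2)[of x] that by (simp add: r_def)
    finally have "(\<lambda>k. a (Suc k) * x ^ Suc k) sums 0" by (simp add: a_def left_diff_distrib)
    then have "(\<lambda>k. a k * x ^ k) sums (0 + a 0 * x ^ 0)" by (subst (asm) sums_Suc_iff) simp
    then show ?thesis by (simp add: a_def)
  qed
  show ?thesis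
  proof (rule ccontr)
    assume "moment N1 k \<noteq> moment N2 k"
    then have "a k \<noteq> 0" "k > 0" by (auto simp: a_def Suc)
    from powser_0_nonzero[OF r sums0 _ this]
    obtain s where "0 < s" "\<And>z::complex. z \<in> cball 0 s - {0} \<Longrightarrow> (0::complex) \<noteq> 0" by auto
    from this(2)[of "of_real s"] this(1) show False by simp
  qed
qed

section \<open>The limit measure\<close>

text \<open>Weak convergence concerns functions on the whole plane; Tietze's theorem extends \<open>h\<close> from \<open>K\<close>, which
  matters for \<open>z \<mapsto> z t / (1 - z t)\<close> with its pole outside \<open>K\<close>.\<close>
lemma weakly_converges_integral:
  fixes h :: "complex \<Rightarrow> complex"
  assumes conv: "weakly_converges M N" and M: "\<And>k. prob_measure_on K (M k)" and N: "prob_measure_on K N"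
    and K: "compact K" and h: "continuous_on K h" "h \<in> borel_measurable borel"
  shows "(\<lambda>k. \<integral>z. h z \<partial>M k) \<longlonglongrightarrow> (\<integral>z. h z \<partial>N)"
proof -
  have "compact (h ` K)" by (intro compact_continuous_image h K)
  then obtain B where B: "\<And>z. z \<in> K \<Longrightarrow> norm (h z) \<le> B"
    using compact_imp_bounded bounded_iff by (metis imageI)
  have B': "norm (h z) \<le> max B 0" if "z \<in> K" for z using B[OF that] by simp
  obtain h' where h': "continuous_on UNIV h'" "\<And>z. z \<in> K \<Longrightarrow> h' z = h z" "\<And>z. norm (h' z) \<le> max B 0"
    using Tietze[OF h(1), of UNIV "max B 0"] B' compact_imp_closed[OF K] by auto
  have h'_meas: "h' \<in> borel_measurable borel" by (rule borel_measurable_continuous_onI[OF h'(1)])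
  have int: "integrable L h'" if "prob_measure_on K L" for L
    by (rule integrable_bounded_on[OF that h'_meas h'(3)])
  have eq: "(\<integral>z. h z \<partial>L) = (\<integral>z. h' z \<partial>L)" if L: "prob_measure_on K L" for L
  proof (rule integral_cong_AE)
    have sL: "sets L = sets borel" using L by (simp add: prob_measure_on_def)
    show "h \<in> borel_measurable L" "h' \<in> borel_measurable L"
      unfolding measurable_cong_sets[OF sL refl] by (rule h(2) h'_meas)+
    have "AE z in L. z \<in> K" using L by (simp add: prob_measure_on_def)
    then show "AE z in L. h z = h' z" by eventually_elim (simp add: h')
  qed
  have part: "(\<lambda>k. T (\<integral>z. h' z \<partial>M k)) \<longlonglongrightarrow> T (\<integral>z. h' z \<partial>N)"
    if T: "bounded_linear T" "\<And>z. \<bar>T z\<bar> \<le> norm z" for T :: "complex \<Rightarrow> real"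
  proof -
    have "\<bar>T (h' z)\<bar> \<le> max B 0" for z using T(2)[of "h' z"] h'(3)[of z] by linarith
    then have "bounded (range (\<lambda>z. T (h' z)))" by (auto simp: bounded_iff)
    moreover have "continuous_on UNIV (\<lambda>z. T (h' z))"
      by (intro linear_continuous_on_compose[OF h'(1)] bounded_linear.linear T)
    ultimately have "(\<lambda>k. \<integral>z. T (h' z) \<partial>M k) \<longlonglongrightarrow> (\<integral>z. T (h' z) \<partial>N)"
      using conv unfolding weakly_converges_def by blast
    then show ?thesis using int M N by (simp add: integral_bounded_linear[OF T(1)])
  qed
  show ?thesis
    unfolding eq[OF M] eq[OF N] tendsto_complex_iff
    using part[OF bounded_linear_Re abs_Re_le_cmod] part[OF bounded_linear_Im abs_Im_le_cmod] by blast
qed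

lemma inv_psi_0 [simp]: "inv_psi \<beta> \<gamma> 0 = 0"
  by (simp add: inv_psi_def)

lemma inv_psi_domain:
  fixes y :: complex
  assumes "norm y < min 1 (norm (\<beta> + 1))"
  shows "1 + y \<noteq> 0" "\<beta> + 1 + y \<noteq> 0"
proof -
  show "1 + y \<noteq> 0" using assms by (auto simp: add_eq_0_iff)
  show "\<beta> + 1 + y \<noteq> 0"
  proof
    assume "\<beta> + 1 + y = 0"
    then have "norm (\<beta> + 1) = norm y" by (metis add_eq_0_iff2 norm_minus_cancel)
    then show False using assms by simp
  qed
qed

lemma inv_psi_holomorphic: "inv_psi \<beta> \<gamma> holomorphic_on ball 0 (min 1 (norm (\<beta> + 1)))"
  unfolding inv_psi_def using inv_psi_domain by (intro holomorphic_intros) auto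

lemma inv_psi_tendsto_0:
  assumes "\<beta> + 1 \<noteq> 0"
  shows "(inv_psi \<beta> \<gamma> \<longlongrightarrow> 0) (at 0)"
proof -
  have "((\<lambda>y. y / (1 + y) * exp (of_real \<gamma> / (\<beta> + 1 + y))) \<longlongrightarrow>
      0 / (1 + 0) * exp (of_real \<gamma> / (\<beta> + 1 + 0))) (at 0)"
    using assms by (intro tendsto_intros) auto
  then show ?thesis by (simp add: inv_psi_def[abs_def])
qed

lemma inv_psi_small:
  assumes "\<beta> + 1 \<noteq> 0" "\<epsilon> > 0"
  shows "\<exists>\<rho>>0. \<forall>y. norm y < \<rho> \<longrightarrow> norm (inv_psi \<beta> \<gamma> y) < \<epsilon>"
proof -
  have "eventually (\<lambda>y. dist (inv_psi \<beta> \<gamma> y) 0 < \<epsilon>) (at 0)"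
    by (rule tendstoD[OF inv_psi_tendsto_0[OF assms(1)] assms(2)])
  then obtain \<rho> where \<rho>: "\<rho> > 0" "\<And>y. y \<noteq> 0 \<Longrightarrow> norm y < \<rho> \<Longrightarrow> norm (inv_psi \<beta> \<gamma> y) < \<epsilon>"
    unfolding eventually_at by (auto simp: dist_norm)
  have "norm (inv_psi \<beta> \<gamma> y) < \<epsilon>" if "norm y < \<rho>" for y
    using \<rho>(2)[OF _ that] assms(2) by (cases "y = 0") auto
  then show ?thesis using \<rho>(1) by blast
qed

text \<open>The parameter \<open>\<beta>\<close> alone tells the two cases apart: in the positive case it is real and outside
  \<open>[-1, 0]\<close>, so its real part is not \<open>-1/2\<close>, the value of the real part in the unitary case.\<close>
definition limit_carrier :: "complex \<Rightarrow> complex set" where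
  "limit_carrier \<beta> = (if Re \<beta> = -1/2 then sphere 0 1 else of_real ` {0..})"

text \<open>Characterisation of the limit by \<open>\<beta>\<close> and \<open>\<gamma>\<close> alone, as the limit must not depend on the sequences.\<close>
definition laguerre_limit :: "complex \<Rightarrow> real \<Rightarrow> complex measure \<Rightarrow> bool" where
  "laguerre_limit \<beta> \<gamma> N \<longleftrightarrow>
     (\<exists>K. compact K \<and> K \<subseteq> limit_carrier \<beta> \<and> prob_measure_on K N) \<and>
     (\<exists>\<rho>>0. \<forall>y. norm y < \<rho> \<longrightarrow> psi N (inv_psi \<beta> \<gamma> y) = y)"

lemma prob_measure_on_mono: "prob_measure_on K N \<Longrightarrow> K \<subseteq> K' \<Longrightarrow> prob_measure_on K' N"
  unfolding prob_measure_on_def by (auto elim: eventually_mono)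

lemma monomials_reduce_limit_carrier: "monomials_reduce (limit_carrier \<beta>)"
  by (simp add: limit_carrier_def monomials_reduce_sphere monomials_reduce_real)

text \<open>A function with a left inverse is injective, and an injective holomorphic function is open.\<close>
lemma inv_psi_locally_onto:
  assumes \<beta>: "\<beta> + 1 \<noteq> 0" and \<rho>: "\<rho> > 0" "\<And>y. norm y < \<rho> \<Longrightarrow> p (inv_psi \<beta> \<gamma> y) = y"
    and \<epsilon>: "\<epsilon> > 0"
  shows "\<exists>\<delta>>0. \<forall>t. norm t < \<delta> \<longrightarrow> (\<exists>y. norm y < \<epsilon> \<and> t = inv_psi \<beta> \<gamma> y)"
proof -
  define \<rho>' where "\<rho>' = min \<epsilon> (min \<rho> (min 1 (norm (\<beta> + 1))))"
  have \<rho>': "\<rho>' > 0" using assms by (simp add: \<rho>'_def)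
  have "inj_on (inv_psi \<beta> \<gamma>) (ball 0 \<rho>')"
    by (rule inj_on_inverseI[where g = p]) (use \<rho>(2) in \<open>auto simp: \<rho>'_def\<close>)
  moreover have "inv_psi \<beta> \<gamma> holomorphic_on ball 0 \<rho>'"
    by (rule holomorphic_on_subset[OF inv_psi_holomorphic]) (auto simp: \<rho>'_def)
  ultimately have "open (inv_psi \<beta> \<gamma> ` ball 0 \<rho>')" by (intro open_mapping_thm3) auto
  moreover have "0 \<in> inv_psi \<beta> \<gamma> ` ball 0 \<rho>'" using \<rho>' by (intro image_eqI[of _ _ 0]) auto
  ultimately obtain \<delta> where \<delta>: "\<delta> > 0" "ball 0 \<delta> \<subseteq> inv_psi \<beta> \<gamma> ` ball 0 \<rho>'"
    using open_contains_ball by blast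
  have "\<exists>y. norm y < \<epsilon> \<and> t = inv_psi \<beta> \<gamma> y" if "norm t < \<delta>" for t
  proof -
    have "t \<in> inv_psi \<beta> \<gamma> ` ball 0 \<rho>'" using \<delta>(2) that by (auto simp: subset_iff)
    then show ?thesis by (auto simp: \<rho>'_def)
  qed
  then show ?thesis using \<delta>(1) by blast
qed

text \<open>Both transforms invert \<open>inv_psi\<close>, whose values fill a neighbourhood of \<open>0\<close>, so they agree there.\<close>
lemma laguerre_limit_unique:
  fixes f :: "complex \<Rightarrow> real"
  assumes \<beta>: "\<beta> + 1 \<noteq> 0" and N: "laguerre_limit \<beta> \<gamma> N1" "laguerre_limit \<beta> \<gamma> N2"
    and f: "continuous_on UNIV f"
  shows "(\<integral>z. f z \<partial>N1) = (\<integral>z. f z \<partial>N2)"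
proof -
  obtain K1 \<rho>1 where 1: "compact K1" "K1 \<subseteq> limit_carrier \<beta>" "prob_measure_on K1 N1"
    "\<rho>1 > 0" "\<And>y. norm y < \<rho>1 \<Longrightarrow> psi N1 (inv_psi \<beta> \<gamma> y) = y"
    using N(1) unfolding laguerre_limit_def by blast
  obtain K2 \<rho>2 where 2: "compact K2" "K2 \<subseteq> limit_carrier \<beta>" "prob_measure_on K2 N2"
    "\<rho>2 > 0" "\<And>y. norm y < \<rho>2 \<Longrightarrow> psi N2 (inv_psi \<beta> \<gamma> y) = y"
    using N(2) unfolding laguerre_limit_def by blast
  define K where "K = K1 \<union> K2"
  have K: "compact K" "K \<subseteq> limit_carrier \<beta>" using 1 2 by (auto simp: K_def)
  have NK: "prob_measure_on K N1" "prob_measure_on K N2"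
    using prob_measure_on_mono[OF 1(3)] prob_measure_on_mono[OF 2(3)] by (auto simp: K_def)
  obtain R where R: "R > 0" "K \<subseteq> cball 0 R"
    using bounded_subset_ballD[OF compact_imp_bounded[OF K(1)], of 0] ball_subset_cball by blast
  obtain \<delta> where \<delta>: "\<delta> > 0" "\<And>t. norm t < \<delta> \<Longrightarrow> \<exists>y. norm y < min \<rho>1 \<rho>2 \<and> t = inv_psi \<beta> \<gamma> y"
    using inv_psi_locally_onto[of \<beta> \<rho>1 "psi N1" \<gamma> "min \<rho>1 \<rho>2"] \<beta> 1(4,5) 2(4) by auto
  have "psi N1 t = psi N2 t" if "norm t < \<delta>" for t
    using \<delta>(2)[OF that] 1(5) 2(5) by auto
  then have "moment N1 k = moment N2 k" for k
    by (rule moments_eq_of_psi_eq[OF NK R(2,1) \<delta>(1)])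
  then show ?thesis
    using integral_eq_of_moments_eq[OF K(1) _ NK _ f] monomials_reduce_subset[OF monomials_reduce_limit_carrier K(2)]
    by blast
qed

text \<open>Without a linear term \<open>\<psi>\<close> would be of second order at \<open>0\<close>, which a function with inverse \<open>inv_psi\<close> is not;
  this is how the mean of the limit measure is seen to be nonzero.\<close>
lemma psi_quadratic:
  assumes N: "prob_measure_on K N" and K: "K \<subseteq> cball 0 R" and R: "R > 0" and t: "R * norm t \<le> 1/2"
    and m: "moment N 1 = 0"
  shows "norm (psi N t) \<le> 2 * R\<^sup>2 * (norm t)\<^sup>2"
proof -
  have ztK: "norm (z * t) \<le> R * norm t" if "z \<in> K" for z
    using K that by (auto simp: norm_mult intro!: mult_right_mono)
  have int: "integrable N (\<lambda>z. z * t / (1 - z * t))"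
  proof (rule integrable_bounded_on[OF N])
    fix z assume "z \<in> K"
    then have b: "norm (z * t) \<le> 1/2" using ztK t by force
    have "norm (z * t / (1 - z * t)) = norm (z * t) * norm (1 / (1 - z * t))"
      by (simp add: norm_mult norm_divide)
    also have "\<dots> \<le> 1/2 * 2" using b norm_le_half_bounds(1)[OF b] by (intro mult_mono) auto
    finally show "norm (z * t / (1 - z * t)) \<le> 1" by simp
  qed measurable
  have int1: "integrable N (\<lambda>z. z * t)"
    by (rule integrable_bounded_on[OF N _ ztK]) measurable
  have "(\<integral>z. z * t \<partial>N) = 0" using m by (simp add: moment_def)
  then have "psi N t = (\<integral>z. z * t / (1 - z * t) - z * t \<partial>N)"
    unfolding psi_eq_integral[OF N K t] using int int1 by simp
  also have "norm \<dots> \<le> 2 * R\<^sup>2 * (norm t)\<^sup>2"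
  proof (rule norm_integral_le_on[OF N])
    fix z assume z: "z \<in> K"
    then have b: "norm (z * t) \<le> 1/2" using ztK t by force
    have "z * t / (1 - z * t) - z * t = (z * t) * (z * t) * (1 / (1 - z * t))"
      using norm_le_half_bounds(2)[OF b] by (simp add: field_simps)
    then have "norm (z * t / (1 - z * t) - z * t) = norm (z * t) * norm (z * t) * norm (1 / (1 - z * t))"
      by (simp only: norm_mult)
    also have "\<dots> \<le> (R * norm t) * (R * norm t) * 2"
      using ztK[OF z] norm_le_half_bounds(1)[OF b] R by (intro mult_mono) auto
    finally show "norm (z * t / (1 - z * t) - z * t) \<le> 2 * R\<^sup>2 * (norm t)\<^sup>2"
      by (simp add: power2_eq_square mult_ac)
  next
    show "(\<lambda>z. z * t / (1 - z * t) - z * t) \<in> borel_measurable borel" by measurable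
  qed simp
  finally show ?thesis .
qed

text \<open>Every small \<open>t\<close> is \<open>inv_psi y\<close> for a small \<open>y\<close>, and then \<open>y\<close> is the value of \<open>psi\<close> at \<open>t\<close>; solving the
  formula for \<open>inv_psi y\<close> for its exponential factor gives the functional equation.\<close>
lemma laguerre_limit_S_transform:
  assumes \<beta>: "\<beta> + 1 \<noteq> 0" and N: "laguerre_limit \<beta> \<gamma> N"
  shows "has_S_transform N (\<lambda>y. exp (of_real \<gamma> / (\<beta> + 1 + y)))"
proof -
  obtain K \<rho> where K: "compact K" "K \<subseteq> limit_carrier \<beta>" "prob_measure_on K N"
    and \<rho>: "\<rho> > 0" "\<And>y. norm y < \<rho> \<Longrightarrow> psi N (inv_psi \<beta> \<gamma> y) = y"
    using N unfolding laguerre_limit_def by blast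
  obtain R where R: "R > 0" "K \<subseteq> cball 0 R"
    using bounded_subset_ballD[OF compact_imp_bounded[OF K(1)], of 0] ball_subset_cball by blast
  have "moment N 1 \<noteq> 0"
  proof
    assume m: "moment N 1 = 0"
    obtain \<rho>' where \<rho>': "\<rho>' > 0" "\<And>y. norm y < \<rho>' \<Longrightarrow> norm (inv_psi \<beta> \<gamma> y) < 1 / (2 * R)"
      using inv_psi_small[OF \<beta>, of "1 / (2 * R)" \<gamma>] R by auto
    have "eventually (\<lambda>y. norm y < min \<rho> \<rho>' \<and> y \<noteq> 0) (at (0::complex))"
      unfolding eventually_at using \<rho>(1) \<rho>'(1) by (intro exI[of _ "min \<rho> \<rho>'"]) (auto simp: dist_norm)
    then have ev: "eventually (\<lambda>y. 1 \<le> 2 * R\<^sup>2 * norm (inv_psi \<beta> \<gamma> y) * norm (exp (of_real \<gamma> / (\<beta> + 1 + y)) / (1 + y))) (at 0)"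
    proof eventually_elim
      case (elim y)
      define t where "t = inv_psi \<beta> \<gamma> y"
      have "R * norm t \<le> 1/2" using \<rho>'(2)[of y] elim R by (simp add: t_def field_simps)
      from psi_quadratic[OF K(3) R(2,1) this m] \<rho>(2)[of y] elim
      have "norm y \<le> 2 * R\<^sup>2 * (norm t)\<^sup>2" by (simp add: t_def)
      also have "\<dots> = 2 * R\<^sup>2 * norm t * norm (exp (of_real \<gamma> / (\<beta> + 1 + y)) / (1 + y)) * norm y"
        by (subst power2_eq_square, subst (2) t_def) (simp add: inv_psi_def norm_mult norm_divide)
      finally show ?case using elim by (simp add: t_def)
    qed
    have "((\<lambda>y. 2 * R\<^sup>2 * norm (inv_psi \<beta> \<gamma> y) * norm (exp (of_real \<gamma> / (\<beta> + 1 + y)) / (1 + y))) \<longlongrightarrow>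
       2 * R\<^sup>2 * norm (0::complex) * norm (exp (of_real \<gamma> / (\<beta> + 1 + 0)) / (1 + 0))) (at 0)"
      using \<beta> by (intro tendsto_intros inv_psi_tendsto_0) auto
    from tendsto_lowerbound[OF this ev] show False by simp
  qed
  moreover have "(\<lambda>y. exp (of_real \<gamma> / (\<beta> + 1 + y))) analytic_on {0}"
    using \<beta> by (intro analytic_intros) auto
  moreover have "eventually (\<lambda>t. exp (of_real \<gamma> / (\<beta> + 1 + psi N t)) = (1 + psi N t) / psi N t * t) (at 0)"
  proof -
    define \<epsilon> where "\<epsilon> = min \<rho> (min 1 (norm (\<beta> + 1)))"
    have \<epsilon>: "\<epsilon> > 0" using \<rho>(1) \<beta> by (simp add: \<epsilon>_def)
    obtain \<delta> where \<delta>: "\<delta> > 0" "\<And>t. norm t < \<delta> \<Longrightarrow> \<exists>y. norm y < \<epsilon> \<and> t = inv_psi \<beta> \<gamma> y"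
      using inv_psi_locally_onto[of \<beta> \<rho> "psi N" \<gamma> \<epsilon>] \<beta> \<rho> \<epsilon> by auto
    have "exp (of_real \<gamma> / (\<beta> + 1 + psi N t)) = (1 + psi N t) / psi N t * t" if t: "norm t < \<delta>" "t \<noteq> 0" for t
    proof -
      obtain y where y: "norm y < \<epsilon>" "t = inv_psi \<beta> \<gamma> y" using \<delta>(2)[OF t(1)] by blast
      have "y \<noteq> 0" using t(2) y(2) by auto
      moreover have "psi N t = y" using \<rho>(2)[of y] y by (simp add: \<epsilon>_def)
      moreover have "1 + y \<noteq> 0" using inv_psi_domain[of y \<beta>] y(1) by (simp add: \<epsilon>_def)
      ultimately show ?thesis by (simp add: y(2) inv_psi_def)
    qed
    then show ?thesis unfolding eventually_at using \<delta>(1) by (intro exI[of _ \<delta>]) (auto simp: dist_norm)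
  qed
  ultimately show ?thesis using K unfolding has_S_transform_def by blast
qed

text \<open>Here \<open>g\<close> parametrises the curve that carries the zeros and \<open>\<theta>\<close> inverts it. The first terms of the sequence,
  for which the zeros may lie elsewhere, are cut off before Helly's theorem is applied.\<close>
lemma laguerre_subsequence_limit:
  fixes P :: "nat \<Rightarrow> complex poly" and g :: "real \<Rightarrow> complex"
  assumes deg: "eventually (\<lambda>n. degree (P n) = n) sequentially"
    and roots: "eventually (\<lambda>n. \<forall>z. poly (P n) z = 0 \<longrightarrow> \<theta> z \<in> {a..b} \<and> g (\<theta> z) = z) sequentially"
    and g: "continuous_on UNIV g" and carrier: "g ` {a..b} \<subseteq> limit_carrier \<beta>" and R: "g ` {a..b} \<subseteq> cball 0 R"
    and \<rho>: "\<rho> > 0" "\<And>y. norm y < \<rho> \<Longrightarrow> R * norm (inv_psi \<beta> \<gamma> y) \<le> 1/2"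
      "\<And>y. norm y < \<rho> \<Longrightarrow> (\<lambda>n. zero_psi (P n) (inv_psi \<beta> \<gamma> y)) \<longlonglongrightarrow> y"
    and s: "strict_mono (s :: nat \<Rightarrow> nat)"
  shows "\<exists>r N. strict_mono (r :: nat \<Rightarrow> nat) \<and> laguerre_limit \<beta> \<gamma> N \<and>
    weakly_converges (\<lambda>k. zero_dist (s (r k)) (P (s (r k)))) N"
proof -
  obtain n0 where n0: "\<And>n. n \<ge> n0 \<Longrightarrow> degree (P n) = n"
    "\<And>n z. n \<ge> n0 \<Longrightarrow> poly (P n) z = 0 \<Longrightarrow> \<theta> z \<in> {a..b} \<and> g (\<theta> z) = z"
    using eventually_conj[OF deg roots] unfolding eventually_sequentially by blast
  \<comment> \<open>The shift by \<open>Suc n0\<close> rather than \<open>n0\<close> also excludes degree \<open>0\<close>.\<close>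
  define u where "u k = s (k + Suc n0)" for k
  have u: "u k \<ge> n0" "u k > 0" for k
    using seq_suble[OF s, of "k + Suc n0"] by (auto simp: u_def)
  have degu: "degree (P (u k)) = u k" for k using n0(1) u by blast
  have rootu: "\<theta> z \<in> {a..b}" "g (\<theta> z) = z" if "poly (P (u k)) z = 0" for k z
    using n0(2)[OF u(1) that] by auto
  have Pu: "P (u k) \<noteq> 0" for k using degu[of k] u(2)[of k] by auto
  define L where "L k = distr (zero_point_measure (P (u k))) borel \<theta>" for k
  have L: "real_distribution (L k)" for k
  proof -
    interpret prob_space "zero_point_measure (P (u k))" by (rule prob_space_zero_point_measure) (use degu u in simp)
    have "prob_space (L k)" unfolding L_def by (rule prob_space_distr) (simp add: measurable_zero_point_measure zero_point_measure_def)
    then show ?thesis by (simp add: real_distribution_def real_distribution_axioms_def L_def)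
  qed
  have supp: "AE x in L k. x \<in> {a..b}" for k
  proof -
    have "AE z in zero_point_measure (P (u k)). \<theta> z \<in> {a..b}"
      by (rule AE_I2) (use rootu(1) in \<open>simp only: space_zero_point_measure mem_Collect_eq\<close>)
    then show ?thesis unfolding L_def by (subst AE_distr_iff) (auto simp: zero_point_measure_def)
  qed
  have gm: "g \<in> borel_measurable borel" by (rule borel_measurable_continuous_onI[OF g])
  have zd: "zero_dist (u k) (P (u k)) = distr (L k) borel g" for k
  proof -
    have "zero_dist (u k) (P (u k)) = distr (zero_point_measure (P (u k))) borel (g \<circ> \<theta>)"
      using zero_dist_eq_distr[OF Pu, of k "g \<circ> \<theta>"] rootu degu by simp
    also have "\<dots> = distr (L k) borel g"
      unfolding L_def using gm by (subst distr_distr) (auto simp: zero_point_measure_def)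
    finally show ?thesis .
  qed
  define K where "K = g ` {a..b}"
  have "\<exists>r N. strict_mono r \<and> prob_measure_on K N \<and> weakly_converges (\<lambda>k. distr (L (r k)) borel g) N"
    unfolding K_def by (rule helly_on_curve[OF L supp g])
  then obtain r N where r: "strict_mono (r :: nat \<Rightarrow> nat)"
    and N: "prob_measure_on K N" and conv: "weakly_converges (\<lambda>k. distr (L (r k)) borel g) N"
    by (elim exE conjE)
  have K: "compact K" unfolding K_def by (intro compact_continuous_image continuous_on_subset[OF g]) auto
  have pm: "prob_measure_on K (distr (L k) borel g)" for k
  proof -
    interpret real_distribution "L k" by (rule L)
    have gL: "g \<in> measurable (L k) borel" using gm by simp
    have "AE x in L k. g x \<in> K" using supp[of k] by eventually_elim (auto simp: K_def)
    then have "AE z in distr (L k) borel g. z \<in> K"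
      using gL compact_imp_closed[OF K] by (subst AE_distr_iff) auto
    then show ?thesis using prob_space_distr[OF gL] by (simp add: prob_measure_on_def)
  qed
  have "psi N (inv_psi \<beta> \<gamma> y) = y" if y: "norm y < \<rho>" for y
  proof -
    define t where "t = inv_psi \<beta> \<gamma> y"
    define h where "h z = z * t / (1 - z * t)" for z
    have t: "R * norm t \<le> 1/2" using \<rho>(2)[OF y] by (simp add: t_def)
    have hm: "h \<in> borel_measurable borel" unfolding h_def[abs_def] by measurable
    have "1 - z * t \<noteq> 0" if "z \<in> K" for z
    proof -
      have "norm z * norm t \<le> R * norm t" using R that by (intro mult_right_mono) (auto simp: K_def)
      then have "norm (z * t) \<le> 1/2" using t by (simp add: norm_mult)
      then show ?thesis by (rule norm_le_half_bounds(2))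
    qed
    then have hc: "continuous_on K h" unfolding h_def[abs_def] by (intro continuous_intros) auto
    have "(\<lambda>k. \<integral>z. h z \<partial>distr (L (r k)) borel g) \<longlonglongrightarrow> (\<integral>z. h z \<partial>N)"
      by (rule weakly_converges_integral[OF conv pm N K hc hm])
    moreover have "(\<integral>z. h z \<partial>distr (L k) borel g) = zero_psi (P (u k)) t" for k
      using integral_zero_dist[of "P (u k)" h] hm degu[of k] u(2)[of k]
      by (simp add: zd zero_psi_def h_def[abs_def])
    ultimately have "(\<lambda>k. zero_psi (P (u (r k))) t) \<longlonglongrightarrow> (\<integral>z. h z \<partial>N)" by simp
    moreover have "(\<lambda>k. zero_psi (P (u (r k))) t) \<longlonglongrightarrow> y"
    proof -
      have "filterlim (\<lambda>k. u (r k)) sequentially sequentially"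
        unfolding u_def using s r
        by (intro filterlim_subseq) (auto simp: strict_mono_def)
      from filterlim_compose[OF \<rho>(3)[OF y] this] show ?thesis by (simp add: t_def)
    qed
    ultimately have "(\<integral>z. h z \<partial>N) = y" by (rule LIMSEQ_unique)
    then show ?thesis
      using psi_eq_integral[OF N R[folded K_def] t] by (simp add: h_def t_def)
  qed
  then have "laguerre_limit \<beta> \<gamma> N"
    unfolding laguerre_limit_def using K N carrier \<rho>(1) K_def by blast
  moreover have "strict_mono (\<lambda>k. r k + Suc n0)" using r by (auto simp: strict_mono_def)
  moreover have "weakly_converges (\<lambda>k. zero_dist (s (r k + Suc n0)) (P (s (r k + Suc n0)))) N"
    using conv by (simp add: zd[symmetric] u_def)
  ultimately show ?thesis by blast
qed

lemma laguerre_limits_exist: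
  fixes b :: "nat \<Rightarrow> complex" and c :: "nat \<Rightarrow> nat"
  assumes b: "(\<lambda>n. b n / of_nat n) \<longlonglongrightarrow> \<beta>" and c: "(\<lambda>n. real (c n) / real n) \<longlonglongrightarrow> \<gamma>" and \<gamma>: "\<gamma> > 0"
    and case': "positive_case b \<beta> \<or> unitary_case b" and s: "strict_mono (s :: nat \<Rightarrow> nat)"
  shows "\<exists>r N. strict_mono (r :: nat \<Rightarrow> nat) \<and> laguerre_limit \<beta> \<gamma> N \<and>
    weakly_converges (\<lambda>k. zero_dist (s (r k)) (mult_laguerre (s (r k)) (b (s (r k))) (c (s (r k))))) N"
    and "\<beta> + 1 \<noteq> 0" and "positive_case b \<beta> \<Longrightarrow> limit_carrier \<beta> = of_real ` {0..}"
    and "unitary_case b \<Longrightarrow> limit_carrier \<beta> = sphere 0 1"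
proof -
  have ev: "eventually (\<lambda>n::nat. n > 0) sequentially" by (rule eventually_gt_at_top)
  have uni: "Re \<beta> = -1/2" if "unitary_case b"
  proof -
    have "eventually (\<lambda>n. Re (b n / of_nat n) = -1/2) sequentially"
      using ev
    proof eventually_elim
      case (elim n)
      then have "Re (b n) = - real n / 2" using that by (simp add: unitary_case_def)
      then show ?case using elim by (simp add: Re_divide_of_nat)
    qed
    from tendsto_cong[OF this] tendsto_Re[OF b] show ?thesis
      by (simp add: LIMSEQ_const_iff)
  qed
  have pos: "\<beta> = of_real (Re \<beta>)" "Re \<beta> \<notin> {-1..0}" if "positive_case b \<beta>"
  proof -
    show eq: "\<beta> = of_real (Re \<beta>)" using that by (auto simp: positive_case_def)
    show "Re \<beta> \<notin> {-1..0}"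
    proof
      assume "Re \<beta> \<in> {-1..0}"
      then have "of_real (Re \<beta>) \<in> complex_of_real ` {-1..0}" by (rule imageI)
      then show False using that eq unfolding positive_case_def by simp
    qed
  qed
  show \<beta>: "\<beta> + 1 \<noteq> 0"
  proof
    assume "\<beta> + 1 = 0"
    then have "Re \<beta> = -1" by (simp add: complex_eq_iff)
    then show False using case' uni pos(2) by auto
  qed
  show carrier_pos: "limit_carrier \<beta> = of_real ` {0..}" if "positive_case b \<beta>"
    using pos(2)[OF that] by (auto simp: limit_carrier_def)
  show carrier_uni: "limit_carrier \<beta> = sphere 0 1" if "unitary_case b"
    using uni[OF that] by (simp add: limit_carrier_def)
  have deg: "eventually (\<lambda>n. degree (mult_laguerre n (b n) (c n)) = n) sequentially"
    using ev
  proof eventually_elim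
    case (elim n)
    have "of_nat n + b n \<noteq> 0"
    proof
      assume "of_nat n + b n = 0"
      then have eq: "b n = - of_nat n" by (simp add: add_eq_0_iff)
      show False using case'
      proof
        assume "unitary_case b"
        then have "Re (b n) = - real n / 2" using elim by (simp add: unitary_case_def)
        then show False using eq elim by simp
      next
        assume "positive_case b \<beta>"
        then have "b n \<notin> complex_of_real ` {- real n..0}" using elim by (simp add: positive_case_def)
        moreover have "b n = of_real (- real n)" using eq by simp
        ultimately show False by (metis atLeastAtMost_iff imageI neg_le_0_iff_le of_nat_0_le_iff order_refl)
      qed
    qed
    then show ?case by (rule degree_mult_laguerre)
  qed
  show "\<exists>r N. strict_mono (r :: nat \<Rightarrow> nat) \<and> laguerre_limit \<beta> \<gamma> N \<and>
    weakly_converges (\<lambda>k. zero_dist (s (r k)) (mult_laguerre (s (r k)) (b (s (r k))) (c (s (r k))))) N"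
    using case'
  proof
    assume P: "positive_case b \<beta>"
    obtain R where R: "R > 0" and roots: "eventually (\<lambda>n. \<forall>k\<le>c n. \<forall>z. poly (mult_laguerre n (b n) k) z = 0 \<longrightarrow>
        z \<in> of_real ` {0<..R}) sequentially"
      using positive_case_zeros_bounded[OF P b c \<gamma>] by blast
    have "eventually (\<lambda>n. \<forall>k\<le>c n. \<forall>z. poly (mult_laguerre n (b n) k) z = 0 \<longrightarrow> norm z \<le> R) sequentially"
      using roots by eventually_elim fastforce
    from zero_psi_tendsto[OF b c \<beta> R this] obtain \<rho> where \<rho>: "\<rho> > 0"
      "\<And>y. norm y < \<rho> \<Longrightarrow> R * norm (inv_psi \<beta> \<gamma> y) \<le> 1/2"
      "\<And>y. norm y < \<rho> \<Longrightarrow> (\<lambda>n. zero_psi (mult_laguerre n (b n) (c n)) (inv_psi \<beta> \<gamma> y)) \<longlonglongrightarrow> y" by blast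
    show ?thesis
    proof (rule laguerre_subsequence_limit[where P = "\<lambda>n. mult_laguerre n (b n) (c n)" and \<theta> = Re
          and a = 0 and b = R and g = of_real, OF deg _ _ _ _ \<rho> s])
      show "eventually (\<lambda>n. \<forall>z. poly (mult_laguerre n (b n) (c n)) z = 0 \<longrightarrow>
          Re z \<in> {0..R} \<and> of_real (Re z) = z) sequentially"
        using roots
      proof eventually_elim
        case (elim n)
        show ?case
        proof (intro allI impI)
          fix z assume "poly (mult_laguerre n (b n) (c n)) z = 0"
          then have "z \<in> of_real ` {0<..R}" using elim by blast
          then show "Re z \<in> {0..R} \<and> of_real (Re z) = z" by auto
        qed
      qed
    qed (auto simp: carrier_pos[OF P] intro!: continuous_intros)
  next
    assume U: "unitary_case b"
    have roots: "eventually (\<lambda>n. \<forall>k\<le>c n. \<forall>z. poly (mult_laguerre n (b n) k) z = 0 \<longrightarrow> norm z = 1) sequentially"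
      using ev
    proof eventually_elim
      case (elim n)
      then show ?case using U mult_laguerre_zeros_unitary[of n "b n"] by (auto simp: unitary_case_def)
    qed
    then have "eventually (\<lambda>n. \<forall>k\<le>c n. \<forall>z. poly (mult_laguerre n (b n) k) z = 0 \<longrightarrow> norm z \<le> 1) sequentially"
      by eventually_elim simp
    from zero_psi_tendsto[OF b c \<beta> _ this] obtain \<rho> where \<rho>: "\<rho> > 0"
      "\<And>y. norm y < \<rho> \<Longrightarrow> 1 * norm (inv_psi \<beta> \<gamma> y) \<le> 1/2"
      "\<And>y. norm y < \<rho> \<Longrightarrow> (\<lambda>n. zero_psi (mult_laguerre n (b n) (c n)) (inv_psi \<beta> \<gamma> y)) \<longlonglongrightarrow> y" by auto
    show ?thesis
    proof (rule laguerre_subsequence_limit[where P = "\<lambda>n. mult_laguerre n (b n) (c n)" and \<theta> = Arg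
          and a = "- pi" and b = pi and g = cis, OF deg _ _ _ _ \<rho> s])
      show "eventually (\<lambda>n. \<forall>z. poly (mult_laguerre n (b n) (c n)) z = 0 \<longrightarrow>
          Arg z \<in> {- pi..pi} \<and> cis (Arg z) = z) sequentially"
        using roots
      proof eventually_elim
        case (elim n)
        show ?case
        proof (intro allI impI)
          fix z assume "poly (mult_laguerre n (b n) (c n)) z = 0"
          then have "norm z = 1" using elim by blast
          then have "z \<noteq> 0" "sgn z = z" by (auto simp: sgn_div_norm)
          then show "Arg z \<in> {- pi..pi} \<and> cis (Arg z) = z"
            using Arg_bounded[of z] cis_Arg[of z] by auto
        qed
      qed
    qed (auto simp: carrier_uni[OF U] intro!: continuous_intros)
  qed
qed

theorem theorem3p3:
  shows "\<exists>\<nu> :: complex \<Rightarrow> real \<Rightarrow> complex measure.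
    \<forall>(b :: nat \<Rightarrow> complex) (c :: nat \<Rightarrow> nat) (\<beta> :: complex) (\<gamma> :: real).
      (\<forall>n\<ge>1. c n \<ge> 1) \<and> \<gamma> > 0 \<and>
      (\<lambda>n. b n / of_nat n) \<longlonglongrightarrow> \<beta> \<and> (\<lambda>n. real (c n) / real n) \<longlonglongrightarrow> \<gamma> \<longrightarrow>
      (positive_case b \<beta> \<longrightarrow>
         prob_measure_on (complex_of_real ` {0..}) (\<nu> \<beta> \<gamma>) \<and>
         weakly_converges (\<lambda>n. zero_dist n (mult_laguerre n (b n) (c n))) (\<nu> \<beta> \<gamma>)) \<and>
      (unitary_case b \<longrightarrow>
         prob_measure_on (sphere 0 1) (\<nu> \<beta> \<gamma>) \<and>
         weakly_converges (\<lambda>n. zero_dist n (mult_laguerre n (b n) (c n))) (\<nu> \<beta> \<gamma>)) \<and>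
      (positive_case b \<beta> \<or> unitary_case b \<longrightarrow>
         has_S_transform (\<nu> \<beta> \<gamma>) (\<lambda>y. exp (of_real \<gamma> / (\<beta> + 1 + y))))"
proof (intro exI[of _ "\<lambda>\<beta> \<gamma>. SOME N. laguerre_limit \<beta> \<gamma> N"] allI impI, elim conjE)
  fix b :: "nat \<Rightarrow> complex" and c :: "nat \<Rightarrow> nat" and \<beta> :: complex and \<gamma> :: real
  assume \<gamma>: "\<gamma> > 0" and b: "(\<lambda>n. b n / of_nat n) \<longlonglongrightarrow> \<beta>" and c: "(\<lambda>n. real (c n) / real n) \<longlonglongrightarrow> \<gamma>"
  define N where "N = (SOME N. laguerre_limit \<beta> \<gamma> N)"
  define M where "M n = zero_dist n (mult_laguerre n (b n) (c n))" for n
  have main: "laguerre_limit \<beta> \<gamma> N \<and> weakly_converges M N \<and> \<beta> + 1 \<noteq> 0"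
    if case': "positive_case b \<beta> \<or> unitary_case b"
  proof -
    note ex = laguerre_limits_exist[OF b c \<gamma> case']
    have \<beta>: "\<beta> + 1 \<noteq> 0" by (rule ex(2)[OF strict_mono_id[unfolded id_def]])
    have "\<exists>N. laguerre_limit \<beta> \<gamma> N" using ex(1)[OF strict_mono_id] by blast
    then have N: "laguerre_limit \<beta> \<gamma> N" unfolding N_def by (rule someI_ex)
    have "weakly_converges M N"
    proof (rule weakly_converges_subseqI)
      fix s :: "nat \<Rightarrow> nat" assume "strict_mono s"
      from ex(1)[OF this] obtain r N' where r: "strict_mono r" and N': "laguerre_limit \<beta> \<gamma> N'"
        and conv: "weakly_converges (\<lambda>k. M (s (r k))) N'" unfolding M_def by blast
      have "weakly_converges (\<lambda>k. M (s (r k))) N"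
        using conv laguerre_limit_unique[OF \<beta> N N'] unfolding weakly_converges_def by simp
      then show "\<exists>r. strict_mono r \<and> weakly_converges (\<lambda>k. M (s (r k))) N" using r by blast
    qed
    then show ?thesis using N \<beta> by blast
  qed
  have carrier: "prob_measure_on (limit_carrier \<beta>) N" if "positive_case b \<beta> \<or> unitary_case b"
    using main[OF that] prob_measure_on_mono unfolding laguerre_limit_def by blast
  have "limit_carrier \<beta> = of_real ` {0..}" if "positive_case b \<beta>"
    using laguerre_limits_exist(3)[OF b c \<gamma> _ strict_mono_id that] that by blast
  moreover have "limit_carrier \<beta> = sphere 0 1" if "unitary_case b"
    using laguerre_limits_exist(4)[OF b c \<gamma> _ strict_mono_id that] that by blast
  ultimately show "(positive_case b \<beta> \<longrightarrow>
         prob_measure_on (complex_of_real ` {0..}) (SOME N. laguerre_limit \<beta> \<gamma> N) \<and>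
         weakly_converges (\<lambda>n. zero_dist n (mult_laguerre n (b n) (c n))) (SOME N. laguerre_limit \<beta> \<gamma> N)) \<and>
      (unitary_case b \<longrightarrow>
         prob_measure_on (sphere 0 1) (SOME N. laguerre_limit \<beta> \<gamma> N) \<and>
         weakly_converges (\<lambda>n. zero_dist n (mult_laguerre n (b n) (c n))) (SOME N. laguerre_limit \<beta> \<gamma> N)) \<and>
      (positive_case b \<beta> \<or> unitary_case b \<longrightarrow>
         has_S_transform (SOME N. laguerre_limit \<beta> \<gamma> N) (\<lambda>y. exp (of_real \<gamma> / (\<beta> + 1 + y))))"
    unfolding N_def[symmetric] M_def[symmetric]
    using main carrier laguerre_limit_S_transform by metis
qed

end
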